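(* Let $A>0$, $\alpha>0$, and let $\delta,\gamma,(\rho_0,u_0)$ satisfy one of the following two sets of assumptions: (i) $0<\delta<1$, $\gamma>1$, $\gamma\ge\delta+\frac12$, and $0<\rho_0\in L^1$, $(\rho_0^{\gamma-1},u_0)\in H^2$, $(\rho_0^{\delta-1})_x\in H^1$, $\partial_xu_0=\rho_0^{\frac{1-\delta}{2}}g_1$, $\alpha\,\partial_x^2u_0=\rho_0^{1-\delta}g_2$ for some $g_1,g_2\in L^2$; (ii) $\delta=1$, $\gamma>\frac32$, and $0<\rho_0\in L^1$, $(\rho_0^{\gamma-1},u_0)\in H^2$, $(\ln\rho_0)_x\in H^1$. Let $(\rho,u)$ be the global solution of the Cauchy problem (CP) with these data, i.e. the unique global classical solution in $(0,\infty)\times\mathbb R$ which for every $0<T<\infty$ is a regular solution in $[0,T]\times\mathbb R$ satisfying the additional regularity (R) (definitions in the context). Assume that $|\mathbb P(0)|>0$, where $\mathbb P(0)=\int_{\mathbb R}\rho_0u_0\,dx$. Then $(\rho,u)$ does not satisfy $$\limsup_{t\to\infty}\|u(t,\cdot)\|_{L^\infty(\mathbb R)}=0.$$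
   Context: All function spaces are over $\mathbb R$: $L^p=L^p(\mathbb R)$, $H^s=H^s(\mathbb R)$, $D^1=\{f\in L^1_{loc}(\mathbb R): f_x\in L^2\}$, and $X([0,T];Y)=X([0,T];Y(\mathbb R))$. The Cauchy problem (CP) is the 1-D isentropic compressible Navier–Stokes system $$\rho_t+(\rho u)_x=0,\qquad (\rho u)_t+(\rho u^2)_x+P(\rho)_x=(\mu(\rho)u_x)_x,$$ with $P(\rho)=A\rho^\gamma$, $\mu(\rho)=\alpha\rho^\delta$, initial data $(\rho,u)(0,x)=(\rho_0,u_0)(x)$ for $x\in\mathbb R$, and far field behavior $(\rho,u)(t,x)\to(0,0)$ as $|x|\to\infty$ for $t\ge0$. Regular solution: for $T>0$, $(\rho,u)$ is a regular solution of (CP) in $[0,T]\times\mathbb R$ if it satisfies (CP) in the sense of distributions, $\inf_{[0,T]\times\mathbb R}\rho=0$, $0<\rho^{\gamma-1}\in C([0,T];H^2)$, $u\in C([0,T];H^2)\cap L^2([0,T];H^3)$, $u_t\in C([0,T];L^2)\cap L^2([0,T];H^1)$, and moreover - if $0<\delta<1$: $(\rho^{\delta-1})_x\in C([0,T];H^1)$, $\rho^{\frac{\delta-1}{2}}u_x\in C([0,T];L^2)$, $\rho^{\frac{\delta-1}{2}}u_{tx}\in L^2([0,T];L^2)$, $\rho^{\delta-1}u_{xx}\in C([0,T];L^2)\cap L^2([0,T];H^1)$; - if $\delta=1$: $(\ln\rho)_x\in C([0,T];H^1)$. Additional regularity (R) on $[0,T]$: $\rho\in C([0,T];L^1)$,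 $(\rho^{\gamma-1})_t\in C([0,T];H^1)$, $t^{\frac12}\rho^{\frac{\delta-1}{2}}u_{tx}\in L^\infty([0,T];L^2)\cap L^2([0,T];D^1)$, $t^{\frac12}u_{tt}\in L^2([0,T];L^2)$, and $(\rho^{\delta-1})_{tx}\in C([0,T];L^2)$ if $0<\delta<1$, respectively $(\ln\rho)_{tx}\in C([0,T];L^2)$ if $\delta=1$. The existence and uniqueness of such a global solution under (i) or (ii) is a theorem that may be taken as given. *)

theory Defs
  imports "HOL-Analysis.Analysis" "HOL-Probability.Essential_Supremum"
begin

section \<open>Test functions and weak derivatives\<close>

primrec dderiv :: "'a list \<Rightarrow> ('a::euclidean_space \<Rightarrow> real) \<Rightarrow> 'a \<Rightarrow> real" where
  "dderiv [] \<phi> = \<phi>"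
| "dderiv (b # bs) \<phi> = (\<lambda>x. frechet_derivative (dderiv bs \<phi>) (at x) b)"

text \<open>\<open>C\<^sub>c\<^sup>\<infinity>(\<Omega>)\<close>: all iterated directional derivatives exist and are again differentiable
  (in particular continuous) on the whole space.\<close>

definition test_functions :: "'a::euclidean_space set \<Rightarrow> ('a \<Rightarrow> real) set" where
  "test_functions \<Omega> = {\<phi>. (\<forall>bs x. dderiv bs \<phi> differentiable (at x)) \<and>
     (\<exists>K. compact K \<and> K \<subseteq> \<Omega> \<and> (\<forall>x. x \<notin> K \<longrightarrow> \<phi> x = 0))}"

definition locally_integrable :: "'a::euclidean_space set \<Rightarrow> ('a \<Rightarrow> real) \<Rightarrow> bool" where
  "locally_integrable \<Omega> f \<longleftrightarrow> (\<forall>K. compact K \<and> K \<subseteq> \<Omega> \<longrightarrow> f absolutely_integrable_on K)"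

text \<open>The distributional derivative of \<open>f\<close> on the open set \<open>\<Omega>\<close>, successively in the directions
  \<open>bs\<close>, is the (locally integrable) function \<open>g\<close>.\<close>

definition has_weak_derivative ::
  "'a::euclidean_space set \<Rightarrow> 'a list \<Rightarrow> ('a \<Rightarrow> real) \<Rightarrow> ('a \<Rightarrow> real) \<Rightarrow> bool" where
  "has_weak_derivative \<Omega> bs f g \<longleftrightarrow> locally_integrable \<Omega> f \<and> locally_integrable \<Omega> g \<and>
     (\<forall>\<phi>\<in>test_functions \<Omega>.
        (LINT x:\<Omega>|lebesgue. f x * dderiv bs \<phi> x)
        = (-1) ^ length bs * (LINT x:\<Omega>|lebesgue. g x * \<phi> x))"


section \<open>Function spaces over the real line\<close>

abbreviation has_wderiv :: "nat \<Rightarrow> (real \<Rightarrow> real) \<Rightarrow> (real \<Rightarrow> real) \<Rightarrow> bool" where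
  "has_wderiv k \<equiv> has_weak_derivative UNIV (replicate k 1)"

text \<open>A representative of the weak derivative of order \<open>k\<close>, which is unique up to null sets;
  meaningful only if that derivative exists.\<close>

definition wderiv :: "nat \<Rightarrow> (real \<Rightarrow> real) \<Rightarrow> real \<Rightarrow> real" where
  "wderiv k f = (SOME g. has_wderiv k f g)"

text \<open>A function space is given by its (representatives of) elements and its (semi)norm.\<close>

record fn_space =
  elems :: "(real \<Rightarrow> real) set"
  fnorm :: "(real \<Rightarrow> real) \<Rightarrow> real"

definition L1 :: fn_space where
  "L1 = \<lparr>elems = {f. integrable lebesgue f}, fnorm = (\<lambda>f. LINT x|lebesgue. \<bar>f x\<bar>)\<rparr>"

definition L2 :: fn_space where
  "L2 = \<lparr>elems = {f \<in> borel_measurable lebesgue. integrable lebesgue (\<lambda>x. (f x)\<^sup>2)},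
         fnorm = (\<lambda>f. sqrt (LINT x|lebesgue. (f x)\<^sup>2))\<rparr>"

definition Linf_norm :: "(real \<Rightarrow> real) \<Rightarrow> ereal" where
  "Linf_norm f = esssup lebesgue (\<lambda>x. ereal \<bar>f x\<bar>)"

definition H :: "nat \<Rightarrow> fn_space" where
  "H k = \<lparr>elems = {f. \<forall>j\<le>k. \<exists>g\<in>elems L2. has_wderiv j f g},
          fnorm = (\<lambda>f. sqrt (\<Sum>j\<le>k. (fnorm L2 (wderiv j f))\<^sup>2))\<rparr>"

definition D1 :: fn_space where
  "D1 = \<lparr>elems = {f. locally_integrable UNIV f \<and> (\<exists>g\<in>elems L2. has_wderiv 1 f g)},
         fnorm = (\<lambda>f. fnorm L2 (wderiv 1 f))\<rparr>"


section \<open>Time-dependent functions on \<open>[0,T] \<times> \<real>\<close>\<close>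

text \<open>Such functions are written \<open>f t x\<close>. For the Lebesgue spaces in time, strong measurability is
  expressed by Lebesgue measurability of \<open>f\<close> in \<open>(t,x)\<close> jointly.\<close>

definition C_T :: "real \<Rightarrow> fn_space \<Rightarrow> (real \<Rightarrow> real \<Rightarrow> real) set" where
  "C_T T Y = {f. (\<forall>t\<in>{0..T}. f t \<in> elems Y) \<and>
     (\<forall>t\<in>{0..T}. ((\<lambda>s. fnorm Y (\<lambda>x. f s x - f t x)) \<longlongrightarrow> 0) (at t within {0..T}))}"

definition L2_T :: "real \<Rightarrow> fn_space \<Rightarrow> (real \<Rightarrow> real \<Rightarrow> real) set" where
  "L2_T T Y = {f. (\<lambda>(t, x). f t x) \<in> borel_measurable (lebesgue_on ({0..T} \<times> UNIV)) \<and>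
     (AE t in lebesgue_on {0..T}. f t \<in> elems Y) \<and>
     (\<lambda>t. (fnorm Y (f t))\<^sup>2) absolutely_integrable_on {0..T}}"

definition Linf_T :: "real \<Rightarrow> fn_space \<Rightarrow> (real \<Rightarrow> real \<Rightarrow> real) set" where
  "Linf_T T Y = {f. (\<lambda>(t, x). f t x) \<in> borel_measurable (lebesgue_on ({0..T} \<times> UNIV)) \<and>
     (\<exists>C. AE t in lebesgue_on {0..T}. f t \<in> elems Y \<and> fnorm Y (f t) \<le> C)}"

abbreviation d_t :: "real \<times> real" where "d_t \<equiv> (1, 0)"
abbreviation d_x :: "real \<times> real" where "d_x \<equiv> (0, 1)"

definition has_wpartial ::
  "real \<Rightarrow> (real \<times> real) list \<Rightarrow> (real \<Rightarrow> real \<Rightarrow> real) \<Rightarrow> (real \<Rightarrow> real \<Rightarrow> real) \<Rightarrow> bool" where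
  "has_wpartial T bs f g \<longleftrightarrow>
     has_weak_derivative ({0<..<T} \<times> UNIV) bs (\<lambda>(t, x). f t x) (\<lambda>(t, x). g t x)"

text \<open>\<open>F\<^sub>t + G\<^sub>x = 0\<close> in the sense of distributions on \<open>(0,T) \<times> \<real>\<close>.\<close>

definition conservation_law ::
  "real \<Rightarrow> (real \<Rightarrow> real \<Rightarrow> real) \<Rightarrow> (real \<Rightarrow> real \<Rightarrow> real) \<Rightarrow> bool" where
  "conservation_law T F G \<longleftrightarrow>
     (let \<Omega> = {0<..<T} \<times> UNIV in
        locally_integrable \<Omega> (\<lambda>(t, x). F t x) \<and> locally_integrable \<Omega> (\<lambda>(t, x). G t x) \<and>
        (\<forall>\<phi>\<in>test_functions \<Omega>.
           (LINT (t, x):\<Omega>|lebesgue. F t x * dderiv [d_t] \<phi> (t, x) + G t x * dderiv [d_x] \<phi> (t, x))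
           = 0))"


section \<open>The Cauchy problem\<close>

definition pressure :: "real \<Rightarrow> real \<Rightarrow> real \<Rightarrow> real" where
  "pressure A \<gamma> r = A * r powr \<gamma>"

definition viscosity :: "real \<Rightarrow> real \<Rightarrow> real \<Rightarrow> real" where
  "viscosity \<alpha> \<delta> r = \<alpha> * r powr \<delta>"

text \<open>The initial data are elements of Lebesgue-type spaces, so they are attained almost everywhere
  (hence everywhere for the continuous representatives).\<close>

definition distributional_solution ::
  "real \<Rightarrow> real \<Rightarrow> real \<Rightarrow> real \<Rightarrow> (real \<Rightarrow> real) \<Rightarrow> (real \<Rightarrow> real) \<Rightarrow> real \<Rightarrow>
   (real \<Rightarrow> real \<Rightarrow> real) \<Rightarrow> (real \<Rightarrow> real \<Rightarrow> real) \<Rightarrow> bool" where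
  "distributional_solution A \<alpha> \<gamma> \<delta> \<rho>0 u0 T \<rho> u \<longleftrightarrow>
     conservation_law T \<rho> (\<lambda>t x. \<rho> t x * u t x) \<and>
     (\<exists>ux. has_wpartial T [d_x] u ux \<and>
        conservation_law T (\<lambda>t x. \<rho> t x * u t x)
          (\<lambda>t x. \<rho> t x * (u t x)\<^sup>2 + pressure A \<gamma> (\<rho> t x) - viscosity \<alpha> \<delta> (\<rho> t x) * ux t x)) \<and>
     (AE x in lebesgue. \<rho> 0 x = \<rho>0 x \<and> u 0 x = u0 x) \<and>
     (\<forall>t\<in>{0..T}. ((\<lambda>x. (\<rho> t x, u t x)) \<longlongrightarrow> (0, 0)) at_infinity)"

text \<open>Below, \<open>\<exists>g. has_wpartial T bs f g \<and> g \<in> X\<close> says that the distributional derivative of \<open>f\<close>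
  has a representative in \<open>X\<close>.\<close>

definition regular_solution ::
  "real \<Rightarrow> real \<Rightarrow> real \<Rightarrow> real \<Rightarrow> (real \<Rightarrow> real) \<Rightarrow> (real \<Rightarrow> real) \<Rightarrow> real \<Rightarrow>
   (real \<Rightarrow> real \<Rightarrow> real) \<Rightarrow> (real \<Rightarrow> real \<Rightarrow> real) \<Rightarrow> bool" where
  "regular_solution A \<alpha> \<gamma> \<delta> \<rho>0 u0 T \<rho> u \<longleftrightarrow>
     T > 0 \<and>
     distributional_solution A \<alpha> \<gamma> \<delta> \<rho>0 u0 T \<rho> u \<and>
     (\<forall>t\<in>{0..T}. \<forall>x. \<rho> t x > 0) \<and>
     (INF (t, x)\<in>{0..T} \<times> UNIV. \<rho> t x) = 0 \<and>
     (\<lambda>t x. \<rho> t x powr (\<gamma> - 1)) \<in> C_T T (H 2) \<and>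
     u \<in> C_T T (H 2) \<inter> L2_T T (H 3) \<and>
     (\<exists>ut. has_wpartial T [d_t] u ut \<and> ut \<in> C_T T L2 \<inter> L2_T T (H 1)) \<and>
     (0 < \<delta> \<and> \<delta> < 1 \<longrightarrow>
        (\<exists>g. has_wpartial T [d_x] (\<lambda>t x. \<rho> t x powr (\<delta> - 1)) g \<and> g \<in> C_T T (H 1)) \<and>
        (\<exists>ux. has_wpartial T [d_x] u ux \<and>
           (\<lambda>t x. \<rho> t x powr ((\<delta> - 1) / 2) * ux t x) \<in> C_T T L2) \<and>
        (\<exists>utx. has_wpartial T [d_t, d_x] u utx \<and>
           (\<lambda>t x. \<rho> t x powr ((\<delta> - 1) / 2) * utx t x) \<in> L2_T T L2) \<and>
        (\<exists>uxx. has_wpartial T [d_x, d_x] u uxx \<and>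
           (\<lambda>t x. \<rho> t x powr (\<delta> - 1) * uxx t x) \<in> C_T T L2 \<inter> L2_T T (H 1))) \<and>
     (\<delta> = 1 \<longrightarrow>
        (\<exists>g. has_wpartial T [d_x] (\<lambda>t x. ln (\<rho> t x)) g \<and> g \<in> C_T T (H 1)))"

definition additional_regularity ::
  "real \<Rightarrow> real \<Rightarrow> real \<Rightarrow> (real \<Rightarrow> real \<Rightarrow> real) \<Rightarrow> (real \<Rightarrow> real \<Rightarrow> real) \<Rightarrow> bool" where
  "additional_regularity \<gamma> \<delta> T \<rho> u \<longleftrightarrow>
     \<rho> \<in> C_T T L1 \<and>
     (\<exists>g. has_wpartial T [d_t] (\<lambda>t x. \<rho> t x powr (\<gamma> - 1)) g \<and> g \<in> C_T T (H 1)) \<and>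
     (\<exists>utx. has_wpartial T [d_t, d_x] u utx \<and>
        (\<lambda>t x. sqrt t * \<rho> t x powr ((\<delta> - 1) / 2) * utx t x) \<in> Linf_T T L2 \<inter> L2_T T D1) \<and>
     (\<exists>utt. has_wpartial T [d_t, d_t] u utt \<and> (\<lambda>t x. sqrt t * utt t x) \<in> L2_T T L2) \<and>
     (0 < \<delta> \<and> \<delta> < 1 \<longrightarrow>
        (\<exists>g. has_wpartial T [d_t, d_x] (\<lambda>t x. \<rho> t x powr (\<delta> - 1)) g \<and> g \<in> C_T T L2)) \<and>
     (\<delta> = 1 \<longrightarrow>
        (\<exists>g. has_wpartial T [d_t, d_x] (\<lambda>t x. ln (\<rho> t x)) g \<and> g \<in> C_T T L2))"

text \<open>The derivatives \<open>\<rho>\<^sub>t, \<rho>\<^sub>x, u\<^sub>t, u\<^sub>x, u\<^sub>x\<^sub>x\<close> exist and are continuous in \<open>(0,\<infinity>) \<times> \<real>\<close>, and the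
  equations hold pointwise there.\<close>

definition classical_solution ::
  "real \<Rightarrow> real \<Rightarrow> real \<Rightarrow> real \<Rightarrow>
   (real \<Rightarrow> real \<Rightarrow> real) \<Rightarrow> (real \<Rightarrow> real \<Rightarrow> real) \<Rightarrow> bool" where
  "classical_solution A \<alpha> \<gamma> \<delta> \<rho> u \<longleftrightarrow>
     (\<forall>t>0. \<forall>x.
        (\<lambda>s. \<rho> s x) differentiable (at t) \<and> \<rho> t differentiable (at x) \<and>
        (\<lambda>s. u s x) differentiable (at t) \<and> u t differentiable (at x) \<and>
        deriv (u t) differentiable (at x)) \<and>
     (let Q = {0<..} \<times> UNIV in
        continuous_on Q (\<lambda>(t, x). \<rho> t x) \<and>
        continuous_on Q (\<lambda>(t, x). deriv (\<lambda>s. \<rho> s x) t) \<and>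
        continuous_on Q (\<lambda>(t, x). deriv (\<rho> t) x) \<and>
        continuous_on Q (\<lambda>(t, x). u t x) \<and>
        continuous_on Q (\<lambda>(t, x). deriv (\<lambda>s. u s x) t) \<and>
        continuous_on Q (\<lambda>(t, x). deriv (u t) x) \<and>
        continuous_on Q (\<lambda>(t, x). deriv (deriv (u t)) x)) \<and>
     (\<forall>t>0. \<forall>x.
        deriv (\<lambda>s. \<rho> s x) t + deriv (\<lambda>y. \<rho> t y * u t y) x = 0 \<and>
        deriv (\<lambda>s. \<rho> s x * u s x) t + deriv (\<lambda>y. \<rho> t y * (u t y)\<^sup>2) x
          + deriv (\<lambda>y. pressure A \<gamma> (\<rho> t y)) x
        = deriv (\<lambda>y. viscosity \<alpha> \<delta> (\<rho> t y) * deriv (u t) y) x)"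

definition global_solution ::
  "real \<Rightarrow> real \<Rightarrow> real \<Rightarrow> real \<Rightarrow> (real \<Rightarrow> real) \<Rightarrow> (real \<Rightarrow> real) \<Rightarrow>
   (real \<Rightarrow> real \<Rightarrow> real) \<Rightarrow> (real \<Rightarrow> real \<Rightarrow> real) \<Rightarrow> bool" where
  "global_solution A \<alpha> \<gamma> \<delta> \<rho>0 u0 \<rho> u \<longleftrightarrow>
     classical_solution A \<alpha> \<gamma> \<delta> \<rho> u \<and>
     (\<forall>T>0. regular_solution A \<alpha> \<gamma> \<delta> \<rho>0 u0 T \<rho> u \<and> additional_regularity \<gamma> \<delta> T \<rho> u)"


section \<open>Assumptions on the parameters and the initial data\<close>

definition assumptions_i ::
  "real \<Rightarrow> real \<Rightarrow> real \<Rightarrow> (real \<Rightarrow> real) \<Rightarrow> (real \<Rightarrow> real) \<Rightarrow> bool" where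
  "assumptions_i \<alpha> \<gamma> \<delta> \<rho>0 u0 \<longleftrightarrow>
     0 < \<delta> \<and> \<delta> < 1 \<and> \<gamma> > 1 \<and> \<gamma> \<ge> \<delta> + 1/2 \<and>
     (\<forall>x. \<rho>0 x > 0) \<and> \<rho>0 \<in> elems L1 \<and>
     (\<lambda>x. \<rho>0 x powr (\<gamma> - 1)) \<in> elems (H 2) \<and> u0 \<in> elems (H 2) \<and>
     (\<exists>r. has_wderiv 1 (\<lambda>x. \<rho>0 x powr (\<delta> - 1)) r \<and> r \<in> elems (H 1)) \<and>
     (\<exists>g1\<in>elems L2. AE x in lebesgue. wderiv 1 u0 x = \<rho>0 x powr ((1 - \<delta>) / 2) * g1 x) \<and>
     (\<exists>g2\<in>elems L2. AE x in lebesgue. \<alpha> * wderiv 2 u0 x = \<rho>0 x powr (1 - \<delta>) * g2 x)"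

definition assumptions_ii ::
  "real \<Rightarrow> real \<Rightarrow> (real \<Rightarrow> real) \<Rightarrow> (real \<Rightarrow> real) \<Rightarrow> bool" where
  "assumptions_ii \<gamma> \<delta> \<rho>0 u0 \<longleftrightarrow>
     \<delta> = 1 \<and> \<gamma> > 3/2 \<and>
     (\<forall>x. \<rho>0 x > 0) \<and> \<rho>0 \<in> elems L1 \<and>
     (\<lambda>x. \<rho>0 x powr (\<gamma> - 1)) \<in> elems (H 2) \<and> u0 \<in> elems (H 2) \<and>
     (\<exists>r. has_wderiv 1 (\<lambda>x. ln (\<rho>0 x)) r \<and> r \<in> elems (H 1))"

definition momentum :: "(real \<Rightarrow> real) \<Rightarrow> (real \<Rightarrow> real) \<Rightarrow> real" where
  "momentum r v = (LINT x|lebesgue. r x * v x)"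

end

theory Submission
  imports Defs
begin

text \<open>Mass and momentum are conserved: integrating each equation over \<open>[-r, r]\<close> leaves boundary
  fluxes, which stay bounded by the one-dimensional Sobolev inequality (applied to \<open>u\<close>, \<open>u\<^sub>x\<close> and
  \<open>\<rho>\<^bsup>\<gamma>-1\<^esup>\<close>) and vanish as \<open>r \<rightarrow> \<infinity>\<close> by the far field behavior. The equations hold only for \<open>t > 0\<close>, so
  the initial momentum is reached by letting \<open>t \<rightarrow> 0\<close>, with \<open>\<rho>\<close> continuous in \<open>L\<^sup>1\<close> and \<open>u\<close> in \<open>L\<^sup>2\<close>.
  If \<open>u\<close> decayed in \<open>L\<^sup>\<infinity>\<close>, then \<open>\<bar>P(0)\<bar> = \<bar>\<integral>\<rho>u dx\<bar> \<le> \<parallel>u(t)\<parallel>\<^sub>\<infinity> \<integral>\<rho> dx \<rightarrow> 0\<close>, as the mass is constant.\<close>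

section \<open>Test functions approximating indicators of intervals\<close>

text \<open>The equations are classical, but the regularity is stated with weak derivatives, and
  \<open>fnorm (H k)\<close> is computed from \<open>wderiv\<close>, an arbitrarily chosen
  representative. A pointwise bound therefore needs two bridges: a classical derivative must be
  recognised as a weak one, and two weak derivatives of the same function must agree almost
  everywhere. The second bridge needs an explicit supply of test functions, which is why the proof
  of a statement about fluid flow has to construct smooth bumps. The other obstacle is uniformity in
  time. For each fixed t the fluxes vanish as |x| grows, but at no known rate, while the
  conservation laws need their integral over a time interval to vanish. Dominated convergence
  settles this once the fluxes have a bound independent of t; it comes from compactness of [0,T] and
  continuity in time with values in H^2.\<close>

text \<open>\<open>exp (-1/(n y)) \<rightarrow> 1\<close> for \<open>y > 0\<close>, so no mollification is needed to approximate the indicator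
  of \<open>(a, b)\<close> by smooth functions. The polynomial factors make the family closed under
  differentiation.\<close>

lemma poly_exp_minus_tendsto_0: "((\<lambda>y. poly p y * exp (- y)) \<longlongrightarrow> (0::real)) at_top"
proof -
  have "((\<lambda>y. \<Sum>i\<le>degree p. coeff p i * (y ^ i / exp y)) \<longlongrightarrow> (\<Sum>i\<le>degree p. coeff p i * 0)) at_top"
    by (intro tendsto_sum tendsto_mult tendsto_const tendsto_power_div_exp_0)
  then show ?thesis
    by (simp add: poly_altdef sum_distrib_right exp_minus divide_inverse mult.assoc)
qed

definition flat :: "real poly \<Rightarrow> real \<Rightarrow> real" where
  "flat p x = (if x > 0 then poly p (1 / x) * exp (- (1 / x)) else 0)"

text \<open>Substitute y = 1/x. Since dy/dx = -y^2, the derivative of p(y) exp(-y) is y^2 (p(y) -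
  p'(y)) exp(-y), and \<open>[:0, 0, 1:]\<close> is the polynomial y^2.\<close>

lemma DERIV_flat: "(flat p has_real_derivative flat ([:0, 0, 1:] * (p - pderiv p)) x) (at x)"
proof -
  consider "x > 0" | "x < 0" | "x = 0" by linarith
  then show ?thesis
  proof cases
    case 1
    have "((\<lambda>y. poly p (1 / y) * exp (- (1 / y))) has_real_derivative
        flat ([:0, 0, 1:] * (p - pderiv p)) x) (at x)"
    proof -
      have "((\<lambda>y. 1 / y) has_real_derivative - (1 / x\<^sup>2)) (at x)"
        using 1 by (auto intro!: derivative_eq_intros simp: power2_eq_square)
      from DERIV_chain2[OF poly_DERIV this] DERIV_chain2[OF DERIV_exp DERIV_minus[OF this]]
      have "((\<lambda>y. poly p (1 / y) * exp (- (1 / y))) has_real_derivative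
        poly (pderiv p) (1 / x) * (- (1 / x\<^sup>2)) * exp (- (1 / x))
          + exp (- (1 / x)) * - (- (1 / x\<^sup>2)) * poly p (1 / x)) (at x)"
        by (rule DERIV_mult)
      also have "poly (pderiv p) (1 / x) * (- (1 / x\<^sup>2)) * exp (- (1 / x))
          + exp (- (1 / x)) * - (- (1 / x\<^sup>2)) * poly p (1 / x) = flat ([:0, 0, 1:] * (p - pderiv p)) x"
        using 1 by (simp add: flat_def power2_eq_square algebra_simps)
      finally show ?thesis .
    qed
    then show ?thesis
      by (rule has_field_derivative_transform_within_open[where S = "{0<..}"])
        (use 1 in \<open>auto simp: flat_def\<close>)
  next
    case 2
    have "((\<lambda>y. 0) has_real_derivative flat ([:0, 0, 1:] * (p - pderiv p)) x) (at x)"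
      using 2 by (simp add: flat_def)
    then show ?thesis
      by (rule has_field_derivative_transform_within_open[where S = "{..<0}"])
        (use 2 in \<open>auto simp: flat_def\<close>)
  next
    case 3
    \<comment> \<open>With y = 1/h the difference quotient \<open>flat p h / h\<close> is y p(y)
      exp(-y); \<open>[:0, 1:]\<close> is the additional factor y.\<close>
    have "((\<lambda>h. poly ([:0, 1:] * p) (1 / h) * exp (- (1 / h))) \<longlongrightarrow> 0) (at_right 0)"
      by (rule filterlim_compose[OF poly_exp_minus_tendsto_0])
        (simp add: divide_inverse filterlim_inverse_at_top_right)
    moreover have "\<forall>\<^sub>F h in at_right 0. poly ([:0, 1:] * p) (1 / h) * exp (- (1 / h)) = flat p h / h"
      by (auto simp: eventually_at_right_less eventually_at_filter flat_def)
    ultimately have "((\<lambda>h. flat p h / h) \<longlongrightarrow> 0) (at_right 0)"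
      by (rule Lim_transform_eventually)
    moreover have "\<forall>\<^sub>F h in at_left 0. 0 = flat p h / h"
      by (auto simp: eventually_at_filter flat_def)
    then have "((\<lambda>h. flat p h / h) \<longlongrightarrow> 0) (at_left 0)"
      by (rule Lim_transform_eventually[OF tendsto_const])
    ultimately show ?thesis
      unfolding DERIV_def using 3 by (auto simp: flat_def intro!: filterlim_split_at)
  qed
qed

text \<open>The linear span of the products, not the products alone: the product rule turns one
  product into a sum of two, scaled by n and -n. Closure under sums and multiples makes the set
  stable under differentiation, hence all its members smooth.\<close>

inductive_set bump_span :: "real \<Rightarrow> real \<Rightarrow> real \<Rightarrow> (real \<Rightarrow> real) set" for n a b where
  base: "(\<lambda>x. flat p (n * (x - a)) * flat q (n * (b - x))) \<in> bump_span n a b"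
| add: "f \<in> bump_span n a b \<Longrightarrow> g \<in> bump_span n a b \<Longrightarrow> (\<lambda>x. f x + g x) \<in> bump_span n a b"
| scale: "f \<in> bump_span n a b \<Longrightarrow> (\<lambda>x. c * f x) \<in> bump_span n a b"

lemma bump_span_DERIV:
  assumes "f \<in> bump_span n a b"
  shows "\<exists>g\<in>bump_span n a b. \<forall>x. (f has_real_derivative g x) (at x)"
  using assms
proof induction
  case (base p q)
  let ?D = "\<lambda>p. [:0, 0, 1:] * (p - pderiv p)"
  let ?g = "\<lambda>x. n * (flat (?D p) (n * (x - a)) * flat q (n * (b - x)))
            + (- n) * (flat p (n * (x - a)) * flat (?D q) (n * (b - x)))"
  have "?g \<in> bump_span n a b"
    by (rule bump_span.add bump_span.scale bump_span.base)+
  moreover have "((\<lambda>x. flat p (n * (x - a)) * flat q (n * (b - x))) has_real_derivative ?g x) (at x)" for x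
  proof -
    have "((\<lambda>x. n * (x - a)) has_real_derivative n) (at x)"
      "((\<lambda>x. n * (b - x)) has_real_derivative - n) (at x)"
      by (auto intro!: derivative_eq_intros)
    from DERIV_mult[OF this[THEN DERIV_chain2[OF DERIV_flat]]] show ?thesis
      by (rule DERIV_cong) (simp only: mult_ac)
  qed
  ultimately show ?case by (intro bexI[where x = ?g]) blast+
next
  case (add f g)
  then obtain f' g' where "f' \<in> bump_span n a b" "g' \<in> bump_span n a b"
    "\<forall>x. (f has_real_derivative f' x) (at x)" "\<forall>x. (g has_real_derivative g' x) (at x)" by blast
  then show ?case
    by (intro bexI[where x = "\<lambda>x. f' x + g' x"] bump_span.add) (auto intro!: derivative_intros)
next
  case (scale f c)
  then obtain f' where "f' \<in> bump_span n a b" "\<forall>x. (f has_real_derivative f' x) (at x)" by blast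
  then show ?case
    by (intro bexI[where x = "\<lambda>x. c * f' x"] bump_span.scale) (auto intro!: DERIV_cmult)
qed

lemma frechet_derivative_eq_DERIV:
  assumes "(f has_real_derivative f') (at x)"
  shows "frechet_derivative f (at x) h = f' * h"
  using frechet_derivative_at[of f "(*) f'" x] assms by (simp add: has_field_derivative_def)

lemma dderiv_bump_span: "f \<in> bump_span n a b \<Longrightarrow> dderiv bs f \<in> bump_span n a b"
proof (induction bs)
  case (Cons h bs)
  then obtain g where g: "g \<in> bump_span n a b" "\<And>x. (dderiv bs f has_real_derivative g x) (at x)"
    using bump_span_DERIV by metis
  then have "dderiv (h # bs) f = (\<lambda>x. h * g x)"
    by (simp add: frechet_derivative_eq_DERIV[OF g(2)] mult.commute)
  then show ?case using g by (simp add: bump_span.scale)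
qed simp

definition bump :: "real \<Rightarrow> real \<Rightarrow> nat \<Rightarrow> real \<Rightarrow> real" where
  "bump a b n x = flat 1 (real n * (x - a)) * flat 1 (real n * (b - x))"

lemma bump_test_function: "bump a b n \<in> test_functions UNIV"
proof -
  have span: "bump a b n \<in> bump_span (real n) a b"
    unfolding bump_def by (rule bump_span.base)
  have "dderiv bs (bump a b n) differentiable (at x)" for bs x
    using bump_span_DERIV[OF dderiv_bump_span[OF span]] real_differentiable_def by blast
  moreover have "bump a b n x = 0" if "x \<notin> cbox a b" for x
    using that by (auto simp: bump_def flat_def zero_less_mult_iff)
  ultimately show ?thesis
    unfolding test_functions_def by (blast intro: compact_cbox)
qed

lemma bump_bounds: "\<bar>bump a b n x\<bar> \<le> indicator {a..b} x"
proof -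
  have *: "flat 1 y \<ge> 0" "flat 1 y \<le> 1" for y by (auto simp: flat_def)
  have "flat 1 (real n * (x - a)) * flat 1 (real n * (b - x)) \<le> 1 * 1"
    by (intro mult_mono *) auto
  moreover have "bump a b n x = 0" if "x \<notin> {a..b}"
    using that by (auto simp: bump_def flat_def zero_less_mult_iff)
  ultimately show ?thesis
    using * by (auto simp: bump_def indicator_def abs_mult)
qed

text \<open>The limit is the indicator of the open interval because every bump is 0 at a and b; the
  two endpoints are negligible for the integrals.\<close>

lemma bump_tendsto_indicator: "(\<lambda>n. bump a b n x) \<longlonglongrightarrow> indicator {a<..<b} x"
proof (cases "x \<in> {a<..<b}")
  case True
  have *: "(\<lambda>n. flat 1 (real n * y)) \<longlonglongrightarrow> 1" if "y > 0" for y
  proof -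
    have "(\<lambda>n. exp (- (inverse (real n) * inverse y))) \<longlonglongrightarrow> exp (- (0 * inverse y))"
      by (intro tendsto_intros lim_inverse_n)
    moreover have "\<forall>\<^sub>F n in sequentially. exp (- (inverse (real n) * inverse y)) = flat 1 (real n * y)"
      using eventually_gt_at_top[of "0::nat"] by eventually_elim (use that in \<open>simp add: flat_def divide_inverse\<close>)
    ultimately show ?thesis by (simp add: Lim_transform_eventually)
  qed
  have "(\<lambda>n. bump a b n x) \<longlonglongrightarrow> 1 * 1"
    unfolding bump_def using True by (intro tendsto_mult *) auto
  then show ?thesis using True by simp
next
  case False
  then have "bump a b n x = 0" for n
    by (auto simp: bump_def flat_def zero_less_mult_iff)
  then show ?thesis using False by simp
qed

section \<open>The fundamental lemma of the calculus of variations\<close>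

lemma AE_eq_0_if_interval_integrals_0:
  fixes h :: "real \<Rightarrow> real"
  assumes int: "\<And>a b. h integrable_on {a..b}" and zero: "\<And>a b. a < b \<Longrightarrow> integral {a..b} h = 0"
  shows "AE x in lebesgue. h x = 0"
proof -
  \<comment> \<open>This is Lebesgue differentiation: off a null set, the means of h over [x, x+k]
    tend to h(x). All these means are 0, so taking e = |h(x)| would give |h(x)| < |h(x)|.\<close>
  obtain N where N: "negligible N"
    "\<And>x e. x \<notin> N \<Longrightarrow> 0 < e \<Longrightarrow> \<exists>d>0. \<forall>k. 0 < k \<and> k < d \<longrightarrow>
        norm (integral (cbox x (x + k *\<^sub>R One)) h /\<^sub>R k ^ DIM(real) - h x) < e"
    using integrable_ccontinuous_explicit[of h] int by (metis box_real(2))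
  have "h x = 0" if "x \<notin> N" for x
  proof (rule ccontr)
    assume "h x \<noteq> 0"
    then have "\<bar>h x\<bar> > 0" by simp
    from N(2)[OF that this] obtain d where "d > 0"
      and d: "\<And>k. 0 < k \<Longrightarrow> k < d \<Longrightarrow> \<bar>integral {x..x + k} h / k - h x\<bar> < \<bar>h x\<bar>"
      by (auto simp: divide_inverse mult.commute)
    show False using d[of "d / 2"] \<open>d > 0\<close> zero[of x "x + d / 2"] by simp
  qed
  then show ?thesis
    using N(1) by (intro AE_I'[of N]) (auto simp: negligible_iff_null_sets)
qed

lemma locally_integrable_interval:
  "locally_integrable UNIV f \<Longrightarrow> f absolutely_integrable_on {a..b::real}"
  by (simp add: locally_integrable_def)

lemma locally_integrable_measurable:
  assumes "locally_integrable UNIV (f :: real \<Rightarrow> real)"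
  shows "f \<in> borel_measurable lebesgue"
proof (rule borel_measurable_LIMSEQ_real)
  show "(\<lambda>n. indicator {- real n..real n} x * f x) \<longlonglongrightarrow> f x" for x
  proof (rule tendsto_eventually)
    obtain N :: nat where "\<bar>x\<bar> \<le> N" using real_arch_simple by blast
    then show "\<forall>\<^sub>F n in sequentially. indicator {- real n..real n} x * f x = f x"
      by (intro eventually_sequentiallyI[of N]) (auto simp: indicator_def)
  qed
  show "(\<lambda>x. indicator {- real n..real n} x * f x) \<in> borel_measurable lebesgue" for n
    using locally_integrable_interval[OF assms, of "- real n" "real n"]
    by (auto simp: set_integrable_def)
qed

lemma integrable_mult_compact_support:
  fixes f \<psi> :: "real \<Rightarrow> real"
  assumes f: "locally_integrable UNIV f" and \<psi>: "\<psi> \<in> borel_measurable lebesgue"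
    and bnd: "\<And>x. \<bar>\<psi> x\<bar> \<le> B" and supp: "\<And>x. x \<notin> {a..b} \<Longrightarrow> \<psi> x = 0"
  shows "integrable lebesgue (\<lambda>x. f x * \<psi> x)"
proof (rule Bochner_Integration.integrable_bound)
  show "integrable lebesgue (\<lambda>x. B * (indicator {a..b} x * f x))"
    using locally_integrable_interval[OF f, of a b] by (simp add: set_integrable_def)
  show "(\<lambda>x. f x * \<psi> x) \<in> borel_measurable lebesgue"
    using locally_integrable_measurable[OF f] \<psi> by simp
  have "\<bar>f x\<bar> * \<bar>\<psi> x\<bar> \<le> \<bar>B\<bar> * \<bar>f x\<bar>" for x
    using mult_right_mono[of "\<bar>\<psi> x\<bar>" "\<bar>B\<bar>" "\<bar>f x\<bar>"] bnd[of x] by (simp add: mult.commute)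
  then show "AE x in lebesgue. norm (f x * \<psi> x) \<le> norm (B * (indicator {a..b} x * f x))"
    using supp by (auto simp: abs_mult indicator_def)
qed

lemma set_lebesgue_integral_UNIV:
  "(LINT x:UNIV|M. f x) = (LINT x|M. f x :: real)"
  by (simp add: set_lebesgue_integral_def)

text \<open>Testing with \<open>bump a b n\<close> and letting n grow shows that f and g have the
  same integral over every interval. Its purpose is the uniqueness of weak derivatives.\<close>

lemma fundamental_lemma_variations:
  fixes f g :: "real \<Rightarrow> real"
  assumes f: "locally_integrable UNIV f" and g: "locally_integrable UNIV g"
    and eq: "\<And>\<phi>. \<phi> \<in> test_functions UNIV \<Longrightarrow> (LINT x|lebesgue. f x * \<phi> x) = (LINT x|lebesgue. g x * \<phi> x)"
  shows "AE x in lebesgue. f x = g x"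
proof -
  have bm: "bump a b n \<in> borel_measurable lebesgue" for a b n
  proof -
    have "bump a b n differentiable (at x)" for x
      using bump_test_function[of a b n] unfolding test_functions_def
      by (metis (mono_tags, lifting) dderiv.simps(1) mem_Collect_eq)
    then have "continuous_on UNIV (bump a b n)"
      by (simp add: continuous_at_imp_continuous_on differentiable_imp_continuous_within)
    then show ?thesis
      by (intro measurable_completion) (simp add: borel_measurable_continuous_onI)
  qed
  have lim: "(\<lambda>n. LINT x|lebesgue. h x * bump a b n x) \<longlonglongrightarrow> integral {a..b} h"
    if h: "locally_integrable UNIV h" for h a b
  proof -
    have "(\<lambda>n. LINT x|lebesgue. h x * bump a b n x) \<longlonglongrightarrow> (LINT x|lebesgue. h x * indicator {a<..<b} x)"
    proof (rule integral_dominated_convergence)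
      show "integrable lebesgue (\<lambda>x. \<bar>indicator {a..b} x * h x\<bar>)"
        using locally_integrable_interval[OF h, of a b] by (simp add: set_integrable_def)
      show "AE x in lebesgue. (\<lambda>n. h x * bump a b n x) \<longlonglongrightarrow> h x * indicator {a<..<b} x"
        by (intro AE_I2 tendsto_mult tendsto_const bump_tendsto_indicator)
      have "\<bar>h x * bump a b n x\<bar> \<le> \<bar>indicator {a..b} x * h x\<bar>" for x n
        using mult_left_mono[OF bump_bounds[of a b n x], of "\<bar>h x\<bar>"] by (simp add: abs_mult mult.commute)
      then show "AE x in lebesgue. norm (h x * bump a b n x) \<le> \<bar>indicator {a..b} x * h x\<bar>" for n
        by simp
    qed (use locally_integrable_measurable[OF h] bm in \<open>auto intro!: borel_measurable_times borel_measurable_indicator\<close>)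
    also have "(LINT x|lebesgue. h x * indicator {a<..<b} x) = (LINT x:{a<..<b}|lebesgue. h x)"
      by (simp add: set_lebesgue_integral_def mult.commute)
    also have "\<dots> = integral {a<..<b} h"
      using locally_integrable_interval[OF h, of a b]
      by (intro set_lebesgue_integral_eq_integral) (simp add: absolutely_integrable_on_Icc_iff_Ioo)
    also have "\<dots> = integral {a..b} h"
      using integral_open_interval_real[of a b h] by simp
    finally show ?thesis .
  qed
  have "AE x in lebesgue. f x - g x = 0"
  proof (rule AE_eq_0_if_interval_integrals_0)
    have int: "f integrable_on {a..b}" "g integrable_on {a..b}" for a b
      using locally_integrable_interval f g set_lebesgue_integral_eq_integral(1) by blast+
    then show "(\<lambda>x. f x - g x) integrable_on {a..b}" for a b
      by (intro integrable_diff)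
    show "integral {a..b} (\<lambda>x. f x - g x) = 0" for a b
    proof -
      have "integral {a..b} f = integral {a..b} g"
        using LIMSEQ_unique[OF lim[OF f, of a b]] lim[OF g, of a b] eq[OF bump_test_function] by simp
      then show ?thesis using int by (simp add: Henstock_Kurzweil_Integration.integral_diff)
    qed
  qed
  then show ?thesis by simp
qed

section \<open>Weak derivatives and Sobolev norms\<close>

lemma dderiv_append: "dderiv (bs @ cs) \<phi> = dderiv bs (dderiv cs \<phi>)"
  by (induction bs) simp_all

lemma dderiv_test_function:
  assumes "\<phi> \<in> test_functions UNIV"
  shows "dderiv bs \<phi> \<in> test_functions UNIV"
proof -
  obtain K where K: "compact K" "\<And>x. x \<notin> K \<Longrightarrow> \<phi> x = 0"
    using assms by (auto simp: test_functions_def)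
  have "dderiv bs \<phi> x = 0" if "x \<notin> K" for bs x
    using that
  proof (induction bs arbitrary: x)
    case (Cons b bs)
    \<comment> \<open>The complement of K is open and the function is constantly 0 on it, so its
      derivative vanishes there and the same K serves for all orders.\<close>
    have "(dderiv bs \<phi> has_derivative (\<lambda>_. 0)) (at x)"
      by (rule has_derivative_transform_within_open[of "\<lambda>_. 0" _ _ _ "- K"])
        (use Cons K in \<open>auto simp: compact_imp_closed open_Compl\<close>)
    from fun_cong[OF frechet_derivative_at[OF this], of b] show ?case by simp
  qed (use K in simp)
  then show ?thesis
    using assms K(1) by (auto simp: test_functions_def dderiv_append[symmetric])
qed

lemma DERIV_test_function:
  fixes \<phi> :: "real \<Rightarrow> real"
  assumes "\<phi> \<in> test_functions UNIV"
  shows "(\<phi> has_real_derivative dderiv [1] \<phi> x) (at x)"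
proof -
  have "dderiv [] \<phi> differentiable (at x)"
    using assms unfolding test_functions_def by blast
  then obtain D where "(\<phi> has_real_derivative D) (at x)"
    by (auto simp: real_differentiable_def)
  then show ?thesis by (simp add: frechet_derivative_eq_DERIV)
qed

lemma continuous_test_function:
  "\<phi> \<in> test_functions UNIV \<Longrightarrow> continuous_on UNIV (\<phi> :: real \<Rightarrow> real)"
  using DERIV_test_function DERIV_continuous_on by blast

lemma continuous_imp_lebesgue_measurable:
  "continuous_on UNIV (f :: real \<Rightarrow> real) \<Longrightarrow> f \<in> borel_measurable lebesgue"
  by (intro measurable_completion) (simp add: borel_measurable_continuous_onI)

text \<open>The support lies in an open interval, so that the function is 0 at R and -R themselves;
  this removes the boundary terms when integrating by parts over [-R,R].\<close>

lemma test_function_bounded_support: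
  fixes \<phi> :: "real \<Rightarrow> real"
  assumes "\<phi> \<in> test_functions UNIV"
  obtains R B where "R > 0" "\<And>x. x \<notin> {-R<..<R} \<Longrightarrow> \<phi> x = 0" "\<And>x. \<bar>\<phi> x\<bar> \<le> B"
proof -
  obtain K where K: "compact K" "\<And>x. x \<notin> K \<Longrightarrow> \<phi> x = 0"
    using assms by (auto simp: test_functions_def)
  obtain R where R: "R > 0" "\<And>x. x \<in> K \<Longrightarrow> \<bar>x\<bar> < R"
    using compact_imp_bounded[OF K(1)] bounded_pos_less[of K] by auto
  have "bounded (\<phi> ` K)"
    using continuous_test_function[OF assms] K(1)
    by (meson compact_continuous_image compact_imp_bounded continuous_on_subset subset_UNIV)
  then obtain B where B: "B > 0" "\<And>x. x \<in> K \<Longrightarrow> \<bar>\<phi> x\<bar> \<le> B"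
    using bounded_pos[of "\<phi> ` K"] by auto
  show ?thesis
  proof (rule that)
    show "\<phi> x = 0" if "x \<notin> {-R<..<R}" for x
      using K(2) R(2)[of x] that by fastforce
    show "\<bar>\<phi> x\<bar> \<le> B" for x
      using B K(2) by (cases "x \<in> K") auto
  qed (rule R)
qed

lemma integrable_mult_test_function:
  fixes f \<phi> :: "real \<Rightarrow> real"
  assumes "locally_integrable UNIV f" and \<phi>: "\<phi> \<in> test_functions UNIV"
  shows "integrable lebesgue (\<lambda>x. f x * \<phi> x)"
proof -
  obtain R B where "\<And>x. x \<notin> {-R<..<R} \<Longrightarrow> \<phi> x = 0" "\<And>x. \<bar>\<phi> x\<bar> \<le> B"
    using test_function_bounded_support[OF \<phi>] by metis
  then show ?thesis
    by (intro integrable_mult_compact_support[where a = "-R" and b = R and B = B] assms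
        continuous_imp_lebesgue_measurable continuous_test_function) auto
qed

lemma continuous_imp_locally_integrable:
  "continuous_on UNIV (f :: real \<Rightarrow> real) \<Longrightarrow> locally_integrable UNIV f"
  unfolding locally_integrable_def set_integrable_def
proof safe
  fix K :: "real set"
  assume f: "continuous_on UNIV f" and K: "compact K"
  then have "integrable lborel (\<lambda>x. indicator K x *\<^sub>R f x)"
    by (intro borel_integrable_compact) (auto intro: continuous_on_subset)
  then show "integrable lebesgue (\<lambda>x. indicator K x *\<^sub>R f x)"
    by (simp add: integrable_completion)
qed

lemma locally_integrable_diff:
  "locally_integrable \<Omega> f \<Longrightarrow> locally_integrable \<Omega> g \<Longrightarrow> locally_integrable \<Omega> (\<lambda>x. f x - g x)"
  by (simp add: locally_integrable_def set_integral_diff)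

lemma has_wderiv_iff:
  "has_wderiv k f g \<longleftrightarrow> locally_integrable UNIV f \<and> locally_integrable UNIV g \<and>
     (\<forall>\<phi>\<in>test_functions UNIV. (LINT x|lebesgue. f x * dderiv (replicate k 1) \<phi> x)
        = (-1) ^ k * (LINT x|lebesgue. g x * \<phi> x))"
  by (simp add: has_weak_derivative_def set_lebesgue_integral_UNIV)

lemma has_wderiv_unique:
  assumes "has_wderiv k f g" "has_wderiv k f h"
  shows "AE x in lebesgue. g x = h x"
  using assms by (intro fundamental_lemma_variations) (auto simp: has_wderiv_iff)

lemma has_wderiv_diff:
  assumes "has_wderiv k f1 g1" "has_wderiv k f2 g2"
  shows "has_wderiv k (\<lambda>x. f1 x - f2 x) (\<lambda>x. g1 x - g2 x)"
  using assms unfolding has_wderiv_iff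
  by (auto simp: locally_integrable_diff left_diff_distrib right_diff_distrib
      integrable_mult_test_function dderiv_test_function)

lemma has_wderiv_0: "locally_integrable UNIV f \<Longrightarrow> has_wderiv 0 f f"
  unfolding has_wderiv_iff by simp

text \<open>For the gauge integral the fundamental theorem asks only that the derivative exist
  everywhere, so \<open>f'\<close> may be discontinuous. The result carries over to the Lebesgue
  integral because both summands are Lebesgue integrable.\<close>

lemma integration_by_parts_test_function:
  fixes f f' \<phi> :: "real \<Rightarrow> real"
  assumes f: "\<And>x. (f has_real_derivative f' x) (at x)" and f': "locally_integrable UNIV f'"
    and \<phi>: "\<phi> \<in> test_functions UNIV"
  shows "(LINT x|lebesgue. f x * dderiv [1] \<phi> x) = - (LINT x|lebesgue. f' x * \<phi> x)"
proof -
  have int: "integrable lebesgue (\<lambda>x. f x * dderiv [1] \<phi> x)" "integrable lebesgue (\<lambda>x. f' x * \<phi> x)"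
    using DERIV_continuous_on[of UNIV f f'] f f'
    by (auto intro!: integrable_mult_test_function continuous_imp_locally_integrable
        dderiv_test_function \<phi> simp del: dderiv.simps)
  obtain R where R: "R > 0" "\<And>x. x \<notin> {-R<..<R} \<Longrightarrow> \<phi> x = 0"
    using test_function_bounded_support[OF \<phi>] by metis
  have supp: "dderiv [1] \<phi> x = 0" if "x \<notin> {-R..R}" for x
  proof -
    have "(\<phi> has_real_derivative 0) (at x)"
      by (rule has_field_derivative_transform_within_open[of "\<lambda>_. 0" _ _ "- {-R..R}"])
        (use that R in \<open>auto simp: open_Compl\<close>)
    then show ?thesis
      using DERIV_unique DERIV_test_function[OF \<phi>] by blast
  qed
  have "((\<lambda>x. f x * dderiv [1] \<phi> x + f' x * \<phi> x) has_integral f R * \<phi> R - f (-R) * \<phi> (-R)) {-R..R}"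
    using R(1) by (intro fundamental_theorem_of_calculus)
      (auto intro!: derivative_eq_intros f[THEN DERIV_subset] DERIV_test_function[OF \<phi>, THEN DERIV_subset]
        simp: has_real_derivative_iff_has_vector_derivative[symmetric] simp del: dderiv.simps)
  then have "((\<lambda>x. f x * dderiv [1] \<phi> x + f' x * \<phi> x) has_integral 0) {-R..R}"
    using R by simp
  then have "((\<lambda>x. f x * dderiv [1] \<phi> x + f' x * \<phi> x) has_integral 0) UNIV"
    by (rule has_integral_on_superset) (use supp R in auto)
  moreover have "((\<lambda>x. f x * dderiv [1] \<phi> x + f' x * \<phi> x) has_integral
      (LINT x|lebesgue. f x * dderiv [1] \<phi> x + f' x * \<phi> x)) UNIV"
    by (intro has_integral_integral_lebesgue Bochner_Integration.integrable_add int)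
  ultimately have "(LINT x|lebesgue. f x * dderiv [1] \<phi> x + f' x * \<phi> x) = 0"
    by (rule has_integral_unique[symmetric])
  then show ?thesis
    using int by (simp del: dderiv.simps)
qed

text \<open>The bridge from classical to weak derivatives. The outermost derivative of the test
  function moves onto f; what remains, \<open>dderiv (replicate k 1) \<phi>\<close>, is again a test
  function, to which \<open>g\<close> applies.\<close>

lemma has_wderiv_Suc:
  assumes f: "\<And>x. (f has_real_derivative f' x) (at x)" and g: "has_wderiv k f' g"
  shows "has_wderiv (Suc k) f g"
  unfolding has_wderiv_iff
proof (intro conjI ballI)
  show "locally_integrable UNIV f"
    using DERIV_continuous_on[of UNIV f f'] f by (intro continuous_imp_locally_integrable) auto
  show "locally_integrable UNIV g" using g by (simp add: has_wderiv_iff)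
next
  fix \<phi> :: "real \<Rightarrow> real"
  assume \<phi>: "\<phi> \<in> test_functions UNIV"
  have "(LINT x|lebesgue. f x * dderiv (replicate (Suc k) 1) \<phi> x)
      = (LINT x|lebesgue. f x * dderiv [1] (dderiv (replicate k 1) \<phi>) x)"
    by simp
  also have "\<dots> = - (LINT x|lebesgue. f' x * dderiv (replicate k 1) \<phi> x)"
    using g by (intro integration_by_parts_test_function f dderiv_test_function \<phi>) (simp add: has_wderiv_iff)
  also have "\<dots> = (-1) ^ Suc k * (LINT x|lebesgue. g x * \<phi> x)"
    using g \<phi> by (simp add: has_wderiv_iff)
  finally show "(LINT x|lebesgue. f x * dderiv (replicate (Suc k) 1) \<phi> x)
      = (-1) ^ Suc k * (LINT x|lebesgue. g x * \<phi> x)" .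
qed

section \<open>Sobolev norms and pointwise bounds\<close>

lemma L2_cong_AE:
  assumes "f \<in> elems L2" "AE x in lebesgue. f x = g x" "g \<in> borel_measurable lebesgue"
  shows "g \<in> elems L2" "fnorm L2 g = fnorm L2 f"
proof -
  have f: "f \<in> borel_measurable lebesgue" "integrable lebesgue (\<lambda>x. (f x)\<^sup>2)"
    using assms(1) by (auto simp: L2_def)
  have ae: "AE x in lebesgue. (f x)\<^sup>2 = (g x)\<^sup>2" using assms(2) by auto
  have "integrable lebesgue (\<lambda>x. (g x)\<^sup>2)"
    using integrable_cong_AE_imp[OF f(2) _ ae] assms(3) by simp
  then show "g \<in> elems L2" using assms(3) by (simp add: L2_def)
  have "(LINT x|lebesgue. (g x)\<^sup>2) = (LINT x|lebesgue. (f x)\<^sup>2)"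
    using ae f(1) assms(3) by (intro integral_cong_AE) auto
  then show "fnorm L2 g = fnorm L2 f" by (simp add: L2_def)
qed

lemma fnorm_H_nonneg: "fnorm (H k) f \<ge> 0"
  by (simp add: H_def sum_nonneg)

text \<open>Frees the norm from the choice made in \<open>wderiv\<close>: weak derivatives of the
  same order agree almost everywhere, so the chosen one has the same L^2 norm as any concrete
  g.\<close>

lemma H_weak_derivative:
  assumes "f \<in> elems (H k)" "j \<le> k" "has_wderiv j f g"
  shows "g \<in> elems L2" "fnorm L2 g \<le> fnorm (H k) f" "fnorm L2 (wderiv j f) = fnorm L2 g"
proof -
  obtain h where h: "h \<in> elems L2" "has_wderiv j f h"
    using assms(1,2) by (auto simp: H_def)
  have meas: "g' \<in> borel_measurable lebesgue" if "has_wderiv j f g'" for g'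
    using that by (auto simp: has_wderiv_iff locally_integrable_measurable)
  note * = L2_cong_AE[OF h(1) has_wderiv_unique[OF h(2)] meas]
  have w: "has_wderiv j f (wderiv j f)"
    unfolding wderiv_def by (rule someI[of "has_wderiv j f", OF h(2)])
  show "g \<in> elems L2" using * assms(3) by blast
  show eq: "fnorm L2 (wderiv j f) = fnorm L2 g" using * assms(3) w by metis
  have "(fnorm L2 (wderiv j f))\<^sup>2 \<le> (\<Sum>j\<le>k. (fnorm L2 (wderiv j f))\<^sup>2)"
    using assms(2) by (intro member_le_sum) auto
  then have "sqrt ((fnorm L2 (wderiv j f))\<^sup>2) \<le> fnorm (H k) f"
    by (simp add: H_def del: real_sqrt_abs)
  then show "fnorm L2 g \<le> fnorm (H k) f" by (simp add: eq)
qed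

lemma fnorm_L2_sq: "(fnorm L2 f)\<^sup>2 = (LINT x|lebesgue. (f x)\<^sup>2)"
  by (simp add: L2_def)

text \<open>A squared substitute for the triangle inequality, obtained by integrating a pointwise
  estimate. The factors 2 do no harm, since the norms only have to be bounded.\<close>

lemma L2_diff:
  assumes "f \<in> elems L2" "g \<in> elems L2"
  shows "(\<lambda>x. f x - g x) \<in> elems L2"
    and "(fnorm L2 f)\<^sup>2 \<le> 2 * (fnorm L2 (\<lambda>x. f x - g x))\<^sup>2 + 2 * (fnorm L2 g)\<^sup>2"
proof -
  have [measurable]: "f \<in> borel_measurable lebesgue" "g \<in> borel_measurable lebesgue"
    and [intro, simp]: "integrable lebesgue (\<lambda>x. (f x)\<^sup>2)" "integrable lebesgue (\<lambda>x. (g x)\<^sup>2)"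
    using assms by (auto simp: L2_def)
  have *: "(a - b)\<^sup>2 \<le> 2 * a\<^sup>2 + 2 * b\<^sup>2" for a b :: real
    using zero_le_power2[of "a + b"] by (simp add: power2_eq_square algebra_simps)
  have int: "integrable lebesgue (\<lambda>x. (f x - g x)\<^sup>2)"
    by (rule Bochner_Integration.integrable_bound[of _ "\<lambda>x. 2 * (f x)\<^sup>2 + 2 * (g x)\<^sup>2"]) (auto simp: *)
  then show "(\<lambda>x. f x - g x) \<in> elems L2" by (simp add: L2_def)
  have "(f x)\<^sup>2 \<le> 2 * (f x - g x)\<^sup>2 + 2 * (g x)\<^sup>2" for x
    using *[of "f x - g x" "- g x"] by simp
  then have "(LINT x|lebesgue. (f x)\<^sup>2) \<le> (LINT x|lebesgue. 2 * (f x - g x)\<^sup>2 + 2 * (g x)\<^sup>2)"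
    using int by (intro integral_mono) auto
  then show "(fnorm L2 f)\<^sup>2 \<le> 2 * (fnorm L2 (\<lambda>x. f x - g x))\<^sup>2 + 2 * (fnorm L2 g)\<^sup>2"
    using int by (simp add: fnorm_L2_sq)
qed

text \<open>The chosen \<open>wderiv\<close> of a difference need not be the difference of the
  chosen ones. The norms are therefore first rewritten with concrete weak derivatives F and G, for
  which subtraction is compatible.\<close>

lemma H_diff:
  assumes f: "f \<in> elems (H k)" and g: "g \<in> elems (H k)"
  shows "(\<lambda>x. f x - g x) \<in> elems (H k)"
    and "(fnorm (H k) f)\<^sup>2 \<le> 2 * (fnorm (H k) (\<lambda>x. f x - g x))\<^sup>2 + 2 * (fnorm (H k) g)\<^sup>2"
proof -
  obtain F where F: "\<And>j. j \<le> k \<Longrightarrow> F j \<in> elems L2 \<and> has_wderiv j f (F j)"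
    using f unfolding H_def by simp metis
  obtain G where G: "\<And>j. j \<le> k \<Longrightarrow> G j \<in> elems L2 \<and> has_wderiv j g (G j)"
    using g unfolding H_def by simp metis
  show d: "(\<lambda>x. f x - g x) \<in> elems (H k)"
    using F G L2_diff(1) has_wderiv_diff unfolding H_def by simp blast
  have "(fnorm L2 (wderiv j f))\<^sup>2 \<le> 2 * (fnorm L2 (wderiv j (\<lambda>x. f x - g x)))\<^sup>2 + 2 * (fnorm L2 (wderiv j g))\<^sup>2"
    if j: "j \<le> k" for j
  proof -
    have F': "F j \<in> elems L2" "has_wderiv j f (F j)" and G': "G j \<in> elems L2" "has_wderiv j g (G j)"
      using F G j by auto
    show ?thesis
      unfolding H_weak_derivative(3)[OF f j F'(2)] H_weak_derivative(3)[OF g j G'(2)]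
        H_weak_derivative(3)[OF d j has_wderiv_diff[OF F'(2) G'(2)]]
      by (rule L2_diff(2)[OF F'(1) G'(1)])
  qed
  then have "(\<Sum>j\<le>k. (fnorm L2 (wderiv j f))\<^sup>2)
    \<le> (\<Sum>j\<le>k. 2 * (fnorm L2 (wderiv j (\<lambda>x. f x - g x)))\<^sup>2 + 2 * (fnorm L2 (wderiv j g))\<^sup>2)"
    by (intro sum_mono) simp
  then show "(fnorm (H k) f)\<^sup>2 \<le> 2 * (fnorm (H k) (\<lambda>x. f x - g x))\<^sup>2 + 2 * (fnorm (H k) g)\<^sup>2"
    by (simp add: H_def sum_nonneg sum.distrib sum_distrib_left)
qed

text \<open>Continuity at t bounds the norm on a neighbourhood of t, and finitely many such
  neighbourhoods cover [0,T].\<close>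

lemma C_T_H_bounded:
  assumes "w \<in> C_T T (H k)"
  obtains C where "C > 0" "\<And>t. t \<in> {0..T} \<Longrightarrow> fnorm (H k) (w t) \<le> C"
proof -
  have w: "\<And>t. t \<in> {0..T} \<Longrightarrow> w t \<in> elems (H k)"
    and lim: "\<And>t. t \<in> {0..T} \<Longrightarrow> ((\<lambda>s. fnorm (H k) (\<lambda>x. w s x - w t x)) \<longlongrightarrow> 0) (at t within {0..T})"
    using assms by (auto simp: C_T_def)
  have "\<exists>U B. open U \<and> t \<in> U \<and> (\<forall>s\<in>U \<inter> {0..T}. fnorm (H k) (w s) \<le> B)" if t: "t \<in> {0..T}" for t
  proof -
    obtain U where U: "open U" "t \<in> U"
      and "\<And>s. s \<in> U \<Longrightarrow> s \<noteq> t \<Longrightarrow> s \<in> {0..T} \<Longrightarrow> fnorm (H k) (\<lambda>x. w s x - w t x) < 1"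
      using order_tendstoD(2)[OF lim[OF t], of 1] unfolding eventually_at_topological by auto
    then have small: "fnorm (H k) (\<lambda>x. w s x - w t x) < 1" if "s \<in> U \<inter> {0..T}" "s \<noteq> t" for s
      using that by blast
    \<comment> \<open>From \<open>H_diff\<close> with the norm of the difference below 1.\<close>
    let ?B = "sqrt (2 + 2 * (fnorm (H k) (w t))\<^sup>2)"
    have "fnorm (H k) (w s) \<le> ?B" if s: "s \<in> U \<inter> {0..T}" for s
    proof (rule real_le_rsqrt)
      show "(fnorm (H k) (w s))\<^sup>2 \<le> 2 + 2 * (fnorm (H k) (w t))\<^sup>2"
      \<comment> \<open>The limit at t says nothing about s = t itself, where the bound is
        trivial.\<close>
      proof (cases "s = t")
        case False
        have "(fnorm (H k) (\<lambda>x. w s x - w t x))\<^sup>2 \<le> 1\<^sup>2"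
          using small[OF s False] fnorm_H_nonneg by (intro power_mono) auto
        then show ?thesis
          using H_diff(2)[of "w s" k "w t"] w s t by fastforce
      qed simp
    qed
    then show ?thesis using U by blast
  qed
  then obtain U B where U: "\<And>t. t \<in> {0..T} \<Longrightarrow> open (U t) \<and> t \<in> U t \<and> (\<forall>s\<in>U t \<inter> {0..T}. fnorm (H k) (w s) \<le> B t)"
    by metis
  obtain D where D: "D \<subseteq> {0..T}" "finite D" "{0..T} \<subseteq> (\<Union>t\<in>D. U t)"
    by (rule compactE_image[of "{0..T}" "{0..T}" U]) (use U in auto)
  show ?thesis
  proof (rule that[of "1 + (\<Sum>t\<in>D. \<bar>B t\<bar>)"])
    show "0 < 1 + (\<Sum>t\<in>D. \<bar>B t\<bar>)" by (simp add: add_pos_nonneg sum_nonneg)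
    fix s assume s: "s \<in> {0..T}"
    then obtain t where t: "t \<in> D" "s \<in> U t" using D by blast
    then have "fnorm (H k) (w s) \<le> B t" using U D s by blast
    also have "B t \<le> (\<Sum>t\<in>D. \<bar>B t\<bar>)"
      using member_le_sum[of t D "\<lambda>t. \<bar>B t\<bar>"] D t by simp
    finally show "fnorm (H k) (w s) \<le> 1 + (\<Sum>t\<in>D. \<bar>B t\<bar>)" by simp
  qed
qed

text \<open>Since (f^2)' = 2 f f' is dominated by f^2 + f'^2, the values of f^2 at two points differ
  by at most S. Averaging over the second point then replaces its value by the L^2 norm.\<close>

lemma Sobolev_bound:
  fixes f f' :: "real \<Rightarrow> real"
  assumes f: "\<And>x. (f has_real_derivative f' x) (at x)" and "f \<in> elems L2" "f' \<in> elems L2"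
  shows "(f x)\<^sup>2 \<le> 2 * (fnorm L2 f)\<^sup>2 + (fnorm L2 f')\<^sup>2"
proof -
  have int: "integrable lebesgue (\<lambda>x. (f x)\<^sup>2)" "integrable lebesgue (\<lambda>x. (f' x)\<^sup>2)"
    using assms(2,3) by (auto simp: L2_def)
  let ?g = "\<lambda>x. (f x)\<^sup>2 + (f' x)\<^sup>2"
  define S where "S = (fnorm L2 f)\<^sup>2 + (fnorm L2 f')\<^sup>2"
  have g: "?g integrable_on UNIV" "integral UNIV ?g = S"
    using integrable_on_lebesgue[of ?g] integral_lebesgue[of ?g] int by (auto simp: S_def fnorm_L2_sq)
  have var: "\<bar>(f b)\<^sup>2 - (f a)\<^sup>2\<bar> \<le> S" if "a \<le> b" for a b
  proof -
    have hi: "((\<lambda>x. 2 * f x * f' x) has_integral (f b)\<^sup>2 - (f a)\<^sup>2) {a..b}"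
      using that by (intro fundamental_theorem_of_calculus)
        (auto intro!: derivative_eq_intros f[THEN DERIV_subset]
          simp: has_real_derivative_iff_has_vector_derivative[symmetric])
    have gi: "?g integrable_on {a..b}"
      using g(1) integrable_on_subinterval by blast
    have "norm (2 * f x * f' x) \<le> ?g x" for x
      using zero_le_power2[of "\<bar>f x\<bar> - \<bar>f' x\<bar>"] by (simp add: abs_mult power2_diff)
    then have "norm (integral {a..b} (\<lambda>x. 2 * f x * f' x)) \<le> integral {a..b} ?g"
      using hi gi by (intro integral_norm_bound_integral) auto
    also have "\<dots> \<le> integral UNIV ?g"
      using gi g by (intro integral_subset_le) auto
    finally show ?thesis
      using integral_unique[OF hi] g(2) by simp
  qed
  have le: "(f x)\<^sup>2 \<le> (f y)\<^sup>2 + S" for y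
    using var[of x y] var[of y x] by (cases "x \<le> y") auto
  \<comment> \<open>Any interval of length 1 would serve, wherever x is, because \<open>le\<close>
    holds for all y. This average contributes the second copy of the squared norm of f.\<close>
  have "(LINT y::real|lebesgue. indicator {0..1} y * (f x)\<^sup>2) \<le> (LINT y|lebesgue. (f y)\<^sup>2 + indicator {0..1} y * S)"
  proof (rule Bochner_Integration.integral_mono)
    show "indicator {0..1} y * (f x)\<^sup>2 \<le> (f y)\<^sup>2 + indicator {0..1} y * S" for y
      using le[of y] by (auto simp: indicator_def)
  qed (use int in \<open>auto intro!: integrable_mult_left\<close>)
  then have "(f x)\<^sup>2 \<le> (fnorm L2 f)\<^sup>2 + S"
    using int by (simp add: fnorm_L2_sq)
  then show ?thesis by (simp add: S_def)
qed

text \<open>Here v is the j-th derivative of w and v' the next one, so one order of H^k is spent on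
  the pointwise bound. Time 0 is excluded because classical derivatives are available only for t >
  0.\<close>

lemma C_T_H_sup_bound:
  assumes w: "w \<in> C_T T (H k)" and k: "Suc j \<le> k"
    and d: "\<And>t x. t \<in> {0<..T} \<Longrightarrow> (v t has_real_derivative v' t x) (at x)"
    and wv: "\<And>t. t \<in> {0<..T} \<Longrightarrow> has_wderiv j (w t) (v t)"
    and wv': "\<And>t. t \<in> {0<..T} \<Longrightarrow> has_wderiv (Suc j) (w t) (v' t)"
  obtains C where "C > 0" "\<And>t x. t \<in> {0<..T} \<Longrightarrow> \<bar>v t x\<bar> \<le> C"
proof -
  obtain C where C: "C > 0" "\<And>t. t \<in> {0..T} \<Longrightarrow> fnorm (H k) (w t) \<le> C"
    using C_T_H_bounded[OF w] by blast
  show ?thesis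
  proof (rule that)
    show "2 * C > 0" using C by simp
    fix t x assume t: "t \<in> {0<..T}"
    then have wt: "w t \<in> elems (H k)" "fnorm (H k) (w t) \<le> C"
      using w C by (auto simp: C_T_def)
    have j: "j \<le> k" using k by simp
    note v = H_weak_derivative(1,2)[OF wt(1) j wv[OF t]] and v' = H_weak_derivative(1,2)[OF wt(1) k wv'[OF t]]
    have "fnorm L2 g \<ge> 0" for g by (simp add: L2_def)
    then have "(fnorm L2 (v t))\<^sup>2 \<le> C\<^sup>2" "(fnorm L2 (v' t))\<^sup>2 \<le> C\<^sup>2"
      using v(2) v'(2) wt(2) by (auto intro!: power_mono)
    \<comment> \<open>3 = 2 + 1 are the coefficients in \<open>Sobolev_bound\<close>; rounding up to
      4 gives the constant 2C.\<close>
    then have "(v t x)\<^sup>2 \<le> 3 * C\<^sup>2"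
      using Sobolev_bound[OF d[OF t] v(1) v'(1), of x] by simp
    also have "\<dots> \<le> (2 * C)\<^sup>2"
      by (simp add: power_mult_distrib)
    finally have "(v t x)\<^sup>2 \<le> (2 * C)\<^sup>2" .
    then show "\<bar>v t x\<bar> \<le> 2 * C"
      using C(1) abs_le_square_iff[of "v t x" "2 * C"] by simp
  qed
qed

section \<open>Conservation of mass and momentum\<close>

lemma integral_interval_tendsto_LINT:
  fixes f :: "real \<Rightarrow> real"
  assumes f: "integrable lebesgue f"
  shows "(\<lambda>n. integral {- real n..real n} f) \<longlonglongrightarrow> (LINT x|lebesgue. f x)"
proof -
  have "(\<lambda>n. LINT x|lebesgue. indicator {- real n..real n} x * f x) \<longlonglongrightarrow> (LINT x|lebesgue. f x)"
  proof (rule integral_dominated_convergence)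
    show "integrable lebesgue (\<lambda>x. \<bar>f x\<bar>)" using f by simp
    have "(\<lambda>n. indicator {- real n..real n} x * f x) \<longlonglongrightarrow> f x" for x
    proof (rule tendsto_eventually)
      obtain N :: nat where "\<bar>x\<bar> \<le> N" using real_arch_simple by blast
      then show "\<forall>\<^sub>F n in sequentially. indicator {- real n..real n} x * f x = f x"
        by (intro eventually_sequentiallyI[of N]) (auto simp: indicator_def)
    qed
    then show "AE x in lebesgue. (\<lambda>n. indicator {- real n..real n} x * f x) \<longlonglongrightarrow> f x" by simp
  qed (use f in \<open>auto simp: abs_mult indicator_le_1 intro!: borel_measurable_times borel_measurable_indicator mult_left_le_one_le\<close>)
  moreover have "(LINT x|lebesgue. indicator {- real n..real n} x * f x) = integral {- real n..real n} f" for n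
  proof -
    have "set_integrable lebesgue {- real n..real n} f"
      unfolding set_integrable_def by (rule integrable_mult_indicator[OF _ f]) simp
    from set_lebesgue_integral_eq_integral(2)[OF this] show ?thesis
      by (simp add: set_lebesgue_integral_def)
  qed
  ultimately show ?thesis by simp
qed

text \<open>The assumptions \<open>F\<close> and \<open>G\<close> together say F_t + G_x = 0.
  Continuity of F' permits differentiation under the integral over [-n,n], which yields the net flux
  through the two endpoints.\<close>

lemma conserved_integral:
  fixes F F' G :: "real \<Rightarrow> real \<Rightarrow> real"
  assumes le: "t1 \<le> t2"
    and F: "\<And>t x. t \<in> {t1..t2} \<Longrightarrow> ((\<lambda>s. F s x) has_real_derivative F' t x) (at t)"
    and F': "continuous_on ({t1..t2} \<times> UNIV) (\<lambda>(t, x). F' t x)"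
    and int: "\<And>t. t \<in> {t1..t2} \<Longrightarrow> integrable lebesgue (F t)"
    and G: "\<And>t x. t \<in> {t1..t2} \<Longrightarrow> (G t has_real_derivative - F' t x) (at x)"
    and G_cont: "\<And>x. continuous_on {t1..t2} (\<lambda>t. G t x)"
    and G_bdd: "\<And>t x. t \<in> {t1..t2} \<Longrightarrow> \<bar>G t x\<bar> \<le> C"
    and G_lim: "\<And>t. t \<in> {t1..t2} \<Longrightarrow> (G t \<longlongrightarrow> 0) at_infinity"
  shows "(LINT x|lebesgue. F t1 x) = (LINT x|lebesgue. F t2 x)"
proof -
  define I where "I n t = integral {- real n..real n} (F t)" for n t
  have I: "((\<lambda>s. G s (- real n) - G s (real n)) has_integral I n t2 - I n t1) {t1..t2}" for n
  proof (rule fundamental_theorem_of_calculus[OF le])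
    fix t assume t: "t \<in> {t1..t2}"
    have "((\<lambda>s. integral (cbox (- real n) (real n)) (F s)) has_real_derivative
        integral (cbox (- real n) (real n)) (F' t)) (at t within {t1..t2})"
    proof (rule leibniz_rule_field_derivative)
      show "F s integrable_on cbox (- real n) (real n)" if "s \<in> {t1..t2}" for s
        using integrable_on_lebesgue[OF int[OF that]] integrable_on_subcbox by blast
      show "continuous_on ({t1..t2} \<times> cbox (- real n) (real n)) (\<lambda>(s, x). F' s x)"
        by (rule continuous_on_subset[OF F']) auto
    qed (use t F in \<open>auto intro: DERIV_subset\<close>)
    moreover have "((\<lambda>x. - F' t x) has_integral G t (real n) - G t (- real n)) {- real n..real n}"
      by (intro fundamental_theorem_of_calculus)
        (auto simp: has_real_derivative_iff_has_vector_derivative[symmetric] intro: DERIV_subset[OF G[OF t]])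
    from integral_unique[OF has_integral_neg[OF this]]
    have "integral (cbox (- real n) (real n)) (F' t) = G t (- real n) - G t (real n)"
      by simp
    ultimately show "(I n has_vector_derivative G t (- real n) - G t (real n)) (at t within {t1..t2})"
      by (simp add: I_def[abs_def] has_real_derivative_iff_has_vector_derivative)
  qed
  \<comment> \<open>\<open>G_lim\<close> is a limit for each time separately; the uniform C provides
    the dominating constant 2C.\<close>
  have "(\<lambda>n. integral {t1..t2} (\<lambda>s. G s (- real n) - G s (real n))) \<longlonglongrightarrow> integral {t1..t2} (\<lambda>s. 0)"
  proof (rule dominated_convergence(2))
    show "(\<lambda>s. G s (- real n) - G s (real n)) integrable_on {t1..t2}" for n
      using I by blast
    show "(\<lambda>_. 2 * C) integrable_on {t1..t2}" by (rule integrable_const_ivl)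
    show "norm (G s (- real n) - G s (real n)) \<le> 2 * C" if "s \<in> {t1..t2}" for n s
      using G_bdd[OF that, of "real n"] G_bdd[OF that, of "- real n"] by simp
    show "(\<lambda>n. G s (- real n) - G s (real n)) \<longlonglongrightarrow> 0" if s: "s \<in> {t1..t2}" for s
    proof -
      have inf: "filterlim (\<lambda>n. real n) at_infinity sequentially"
        by (simp add: filterlim_at_top_imp_at_infinity filterlim_real_sequentially)
      have "filterlim (\<lambda>n. - real n) at_infinity sequentially"
        using inf by (simp add: filterlim_at_infinity[of 0] )
      from tendsto_diff[OF filterlim_compose[OF G_lim[OF s] this] filterlim_compose[OF G_lim[OF s] inf]]
      show ?thesis by simp
    qed
  qed
  then have "(\<lambda>n. I n t2 - I n t1) \<longlonglongrightarrow> 0"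
    by (simp add: integral_unique[OF I])
  moreover have "(\<lambda>n. I n t2 - I n t1) \<longlonglongrightarrow> (LINT x|lebesgue. F t2 x) - (LINT x|lebesgue. F t1 x)"
    unfolding I_def using le by (intro tendsto_diff integral_interval_tendsto_LINT int) auto
  ultimately show ?thesis
    using LIMSEQ_unique by fastforce
qed

section \<open>The limit of the momentum at time zero\<close>

lemma integrable_mult_bounded:
  fixes f g :: "real \<Rightarrow> real"
  assumes "integrable lebesgue f" "g \<in> borel_measurable lebesgue" "AE x in lebesgue. \<bar>g x\<bar> \<le> C"
  shows "integrable lebesgue (\<lambda>x. f x * g x)"
proof (rule Bochner_Integration.integrable_bound)
  show "integrable lebesgue (\<lambda>x. C * f x)" using assms(1) by simp
  show "AE x in lebesgue. norm (f x * g x) \<le> norm (C * f x)"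
    using assms(3)
  proof eventually_elim
    case (elim x)
    then have "\<bar>g x\<bar> * \<bar>f x\<bar> \<le> \<bar>C\<bar> * \<bar>f x\<bar>" by (intro mult_right_mono) auto
    then show ?case by (simp add: abs_mult mult.commute)
  qed
qed (use assms in auto)

lemma H_locally_integrable: "f \<in> elems (H k) \<Longrightarrow> locally_integrable UNIV f"
  by (auto simp: H_def has_wderiv_iff)

text \<open>The change of the product is (\<open>\<rho> s\<close> - \<open>\<rho> 0\<close>)
  \<open>u s\<close> + \<open>\<rho> 0\<close> (\<open>u s\<close> - \<open>u 0\<close>). The first
  term is small in L^1 because u is bounded. In the second, u converges in L^2 while the density is
  only assumed in L^1, so Hoelder's inequality does not apply; almost everywhere convergence along a
  subsequence and domination by a multiple of |\<open>\<rho> 0\<close>| do. Hence the conclusion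
  speaks of a sequence of times.\<close>

lemma momentum_initial_limit:
  assumes T: "T > 0" and \<rho>: "\<rho> \<in> C_T T L1" and u: "u \<in> C_T T (H k)"
    and bdd: "\<And>t x. t \<in> {0<..T} \<Longrightarrow> \<bar>u t x\<bar> \<le> C"
  obtains s :: "nat \<Rightarrow> real" where "\<And>n. s n \<in> {0<..T}"
    "(\<lambda>n. momentum (\<rho> (s n)) (u (s n))) \<longlonglongrightarrow> momentum (\<rho> 0) (u 0)"
proof -
  define s where "s n = T / real (Suc n)" for n
  have s: "s n \<in> {0<..T}" for n
    using T by (auto simp: s_def field_simps)
  have u_meas: "u t \<in> borel_measurable lebesgue" if "t \<in> {0..T}" for t
  proof -
    have "u t \<in> elems (H k)" using u that by (simp add: C_T_def)
    from locally_integrable_measurable[OF H_locally_integrable[OF this]] show ?thesis .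
  qed
  have "s \<longlonglongrightarrow> 0"
    unfolding s_def using lim_const_over_n[of T] LIMSEQ_Suc by blast
  moreover have "s n \<in> {0..T} \<and> s n \<noteq> 0" for n
    using s[of n] by auto
  ultimately have s_lim: "filterlim s (at 0 within {0..T}) sequentially"
    unfolding filterlim_at by (intro conjI always_eventually) auto
  define d where "d n x = (u (s n) x - u 0 x)\<^sup>2" for n x
  have d_H: "(\<lambda>x. u (s n) x - u 0 x) \<in> elems (H k)" for n
    using u s[of n] T by (intro H_diff) (auto simp: C_T_def)
  have d_loc: "has_wderiv 0 (\<lambda>x. u (s n) x - u 0 x) (\<lambda>x. u (s n) x - u 0 x)" for n
    by (rule has_wderiv_0[OF H_locally_integrable[OF d_H]])
  have d_int: "integrable lebesgue (d n)" for n
    using H_weak_derivative(1)[OF d_H _ d_loc] by (simp add: d_def[abs_def] L2_def)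
  have "((\<lambda>t. fnorm (H k) (\<lambda>x. u t x - u 0 x)) \<longlongrightarrow> 0) (at 0 within {0..T})"
    using u T by (auto simp: C_T_def)
  from tendsto_power[OF filterlim_compose[OF this s_lim], of 2]
  have H_lim: "(\<lambda>n. (fnorm (H k) (\<lambda>x. u (s n) x - u 0 x))\<^sup>2) \<longlonglongrightarrow> 0" by simp
  have "(\<lambda>n. LINT x|lebesgue. norm (d n x)) \<longlonglongrightarrow> 0"
  proof (rule tendsto_sandwich[OF _ _ tendsto_const H_lim])
    have "(LINT x|lebesgue. norm (d n x)) \<le> (fnorm (H k) (\<lambda>x. u (s n) x - u 0 x))\<^sup>2" for n
      using power_mono[OF H_weak_derivative(2)[OF d_H _ d_loc], of _ 2]
      by (simp add: fnorm_L2_sq d_def) (simp add: L2_def)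
    then show "\<forall>\<^sub>F n in sequentially. (LINT x|lebesgue. norm (d n x)) \<le> (fnorm (H k) (\<lambda>x. u (s n) x - u 0 x))\<^sup>2"
      by simp
  qed simp
  then obtain r :: "nat \<Rightarrow> nat" where r: "strict_mono r" "AE x in lebesgue. (\<lambda>n. d (r n) x) \<longlonglongrightarrow> 0"
    using tendsto_L1_AE_subseq[of lebesgue d, OF d_int] by blast
  have lim: "AE x in lebesgue. (\<lambda>n. u (s (r n)) x) \<longlonglongrightarrow> u 0 x"
    using r(2)
  proof eventually_elim
    case (elim x)
    then have "(\<lambda>n. \<bar>u (s (r n)) x - u 0 x\<bar>) \<longlonglongrightarrow> 0"
      using tendsto_real_sqrt[OF elim] by (simp add: d_def)
    then show ?case
      by (simp add: LIM_zero_iff tendsto_rabs_zero_iff)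
  qed
  \<comment> \<open>The bound C is assumed for positive times only; at time 0 it is inherited
    through the limit, hence almost everywhere.\<close>
  have bdd0: "AE x in lebesgue. \<bar>u 0 x\<bar> \<le> C"
    using lim
  proof eventually_elim
    case (elim x)
    show ?case
      by (rule Lim_bounded[OF tendsto_rabs[OF elim], of 0]) (use bdd s in auto)
  qed
  have \<rho>_int: "integrable lebesgue (\<rho> t)" if "t \<in> {0..T}" for t
    using \<rho> that by (auto simp: C_T_def L1_def)
  have 0: "0 \<in> {0..T}" and sr: "s (r n) \<in> {0..T}" for n using T s[of "r n"] by auto
  have i1: "integrable lebesgue (\<lambda>x. (\<rho> (s (r n)) x - \<rho> 0 x) * u (s (r n)) x)" for n
    using \<rho>_int 0 sr s u_meas by (intro integrable_mult_bounded[where C = C]) (auto simp: bdd)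
  have diff_bdd: "AE x in lebesgue. \<bar>u (s (r n)) x - u 0 x\<bar> \<le> 2 * C" for n
    using bdd0
  proof eventually_elim
    case (elim x)
    then show ?case using bdd[OF s, of "r n" x] by linarith
  qed
  have i2: "integrable lebesgue (\<lambda>x. \<rho> 0 x * (u (s (r n)) x - u 0 x))" for n
    using \<rho>_int 0 sr u_meas
    by (intro integrable_mult_bounded[OF _ _ diff_bdd]) auto
  have i3: "integrable lebesgue (\<lambda>x. \<rho> 0 x * u 0 x)"
    using \<rho>_int 0 u_meas bdd0 by (intro integrable_mult_bounded[where C = C]) auto
  have split: "momentum (\<rho> (s (r n))) (u (s (r n))) =
      (LINT x|lebesgue. (\<rho> (s (r n)) x - \<rho> 0 x) * u (s (r n)) x)
      + (LINT x|lebesgue. \<rho> 0 x * (u (s (r n)) x - u 0 x)) + momentum (\<rho> 0) (u 0)" for n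
  proof -
    have "momentum (\<rho> (s (r n))) (u (s (r n))) = (LINT x|lebesgue. ((\<rho> (s (r n)) x - \<rho> 0 x) * u (s (r n)) x
      + \<rho> 0 x * (u (s (r n)) x - u 0 x)) + \<rho> 0 x * u 0 x)"
      unfolding momentum_def by (intro Bochner_Integration.integral_cong) (auto simp: algebra_simps)
    then show ?thesis
      using i1[of n] i2[of n] i3 by (simp add: momentum_def)
  qed
  have "((\<lambda>t. fnorm L1 (\<lambda>x. \<rho> t x - \<rho> 0 x)) \<longlongrightarrow> 0) (at 0 within {0..T})"
    using \<rho> T by (auto simp: C_T_def)
  then have "(\<lambda>n. fnorm L1 (\<lambda>x. \<rho> (s (r n)) x - \<rho> 0 x)) \<longlonglongrightarrow> 0"
    using filterlim_compose[OF _ filterlim_compose[OF s_lim filterlim_subseq[OF r(1)]]] by blast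
  from tendsto_mult_left[OF this, of C]
  have L1_lim: "(\<lambda>n. C * (LINT x|lebesgue. \<bar>\<rho> (s (r n)) x - \<rho> 0 x\<bar>)) \<longlonglongrightarrow> 0"
    by (simp add: L1_def)
  have lim1: "(\<lambda>n. LINT x|lebesgue. (\<rho> (s (r n)) x - \<rho> 0 x) * u (s (r n)) x) \<longlonglongrightarrow> 0"
  proof (rule Lim_null_comparison[OF always_eventually L1_lim], rule allI)
    fix n
    have "norm (LINT x|lebesgue. (\<rho> (s (r n)) x - \<rho> 0 x) * u (s (r n)) x)
        \<le> (LINT x|lebesgue. C * \<bar>\<rho> (s (r n)) x - \<rho> 0 x\<bar>)"
    proof (rule order_trans[OF integral_norm_bound Bochner_Integration.integral_mono])
      show "norm ((\<rho> (s (r n)) x - \<rho> 0 x) * u (s (r n)) x) \<le> C * \<bar>\<rho> (s (r n)) x - \<rho> 0 x\<bar>" for x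
        using mult_left_mono[OF bdd[OF s, of "r n" x], of "\<bar>\<rho> (s (r n)) x - \<rho> 0 x\<bar>"]
        by (simp add: abs_mult mult.commute)
    qed (use i1 \<rho>_int 0 sr in auto)
    then show "norm (LINT x|lebesgue. (\<rho> (s (r n)) x - \<rho> 0 x) * u (s (r n)) x)
        \<le> C * (LINT x|lebesgue. \<bar>\<rho> (s (r n)) x - \<rho> 0 x\<bar>)" by simp
  qed
  have "(\<lambda>n. LINT x|lebesgue. \<rho> 0 x * (u (s (r n)) x - u 0 x)) \<longlonglongrightarrow> (LINT x::real|lebesgue. 0)"
  proof (rule integral_dominated_convergence)
    show "integrable lebesgue (\<lambda>x. 2 * C * \<bar>\<rho> 0 x\<bar>)" using \<rho>_int[OF 0] by simp
    show "AE x in lebesgue. (\<lambda>n. \<rho> 0 x * (u (s (r n)) x - u 0 x)) \<longlonglongrightarrow> 0"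
      using lim by eventually_elim (simp add: LIM_zero tendsto_mult_right_zero)
    show "AE x in lebesgue. norm (\<rho> 0 x * (u (s (r n)) x - u 0 x)) \<le> 2 * C * \<bar>\<rho> 0 x\<bar>" for n
      using diff_bdd[of n]
    proof eventually_elim
      case (elim x)
      from mult_left_mono[OF this, of "\<bar>\<rho> 0 x\<bar>"] show ?case by (simp add: abs_mult mult_ac)
    qed
  qed (use i2 in auto)
  from tendsto_add[OF tendsto_add[OF lim1 this] tendsto_const[of "momentum (\<rho> 0) (u 0)"]]
  have "(\<lambda>n. momentum (\<rho> (s (r n))) (u (s (r n)))) \<longlonglongrightarrow> momentum (\<rho> 0) (u 0)"
    by (simp add: split)
  then show ?thesis using that[of "\<lambda>n. s (r n)"] s by blast
qed

lemma continuous_on_slices: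
  assumes "continuous_on ({0<..} \<times> UNIV) (\<lambda>(t, x). f t x :: real)"
  shows "t > 0 \<Longrightarrow> continuous_on UNIV (f t)" "continuous_on {0<..} (\<lambda>t. f t (x :: real))"
proof -
  have "continuous_on UNIV (\<lambda>x. case (t, x) of (t, x) \<Rightarrow> f t x)" if "t > 0"
    using that by (intro continuous_on_compose2[OF assms]) (auto intro!: continuous_intros)
  then show "t > 0 \<Longrightarrow> continuous_on UNIV (f t)" by simp
  have "continuous_on {0<..} (\<lambda>t. case (t, x) of (t, x) \<Rightarrow> f t x)"
    by (intro continuous_on_compose2[OF assms]) (auto intro!: continuous_intros)
  then show "continuous_on {0<..} (\<lambda>t. f t x)" by simp
qed

section \<open>Bounds and conservation laws for the global solution\<close>

context
  fixes A \<alpha> \<gamma> \<delta> :: real and \<rho>0 u0 :: "real \<Rightarrow> real" and \<rho> u :: "real \<Rightarrow> real \<Rightarrow> real"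
  assumes sol: "global_solution A \<alpha> \<gamma> \<delta> \<rho>0 u0 \<rho> u" and \<gamma>: "\<gamma> > 1" and \<delta>: "\<delta> > 0"
begin

lemma regular: "T > 0 \<Longrightarrow> regular_solution A \<alpha> \<gamma> \<delta> \<rho>0 u0 T \<rho> u"
  using sol by (simp add: global_solution_def)

lemma density_pos: "t \<ge> 0 \<Longrightarrow> \<rho> t x > 0"
  using regular[of "t + 1"] by (simp add: regular_solution_def)

lemma far_field:
  assumes "t \<ge> 0"
  shows "(\<rho> t \<longlongrightarrow> 0) at_infinity" "(u t \<longlongrightarrow> 0) at_infinity"
proof -
  have "((\<lambda>x. (\<rho> t x, u t x)) \<longlongrightarrow> (0, 0)) at_infinity"
    using regular[of "t + 1"] assms by (simp add: regular_solution_def distributional_solution_def)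
  from tendsto_fst[OF this] tendsto_snd[OF this]
  show "(\<rho> t \<longlongrightarrow> 0) at_infinity" "(u t \<longlongrightarrow> 0) at_infinity" by simp_all
qed

lemma classical: "classical_solution A \<alpha> \<gamma> \<delta> \<rho> u"
  using sol by (simp add: global_solution_def)

lemma classical_derivatives:
  assumes "t > 0"
  shows "((\<lambda>s. \<rho> s x) has_real_derivative deriv (\<lambda>s. \<rho> s x) t) (at t)"
    and "(\<rho> t has_real_derivative deriv (\<rho> t) x) (at x)"
    and "((\<lambda>s. u s x) has_real_derivative deriv (\<lambda>s. u s x) t) (at t)"
    and "(u t has_real_derivative deriv (u t) x) (at x)"
    and "(deriv (u t) has_real_derivative deriv (deriv (u t)) x) (at x)"
  using classical assms unfolding DERIV_deriv_iff_real_differentiable classical_solution_def by blast+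

lemma classical_continuity:
  "continuous_on ({0<..} \<times> UNIV) (\<lambda>(t, x). \<rho> t x)"
  "continuous_on ({0<..} \<times> UNIV) (\<lambda>(t, x). deriv (\<lambda>s. \<rho> s x) t)"
  "continuous_on ({0<..} \<times> UNIV) (\<lambda>(t, x). deriv (\<rho> t) x)"
  "continuous_on ({0<..} \<times> UNIV) (\<lambda>(t, x). u t x)"
  "continuous_on ({0<..} \<times> UNIV) (\<lambda>(t, x). deriv (\<lambda>s. u s x) t)"
  "continuous_on ({0<..} \<times> UNIV) (\<lambda>(t, x). deriv (u t) x)"
  "continuous_on ({0<..} \<times> UNIV) (\<lambda>(t, x). deriv (deriv (u t)) x)"
  using classical by (simp_all add: classical_solution_def Let_def)

lemma velocity_in_H2: "T > 0 \<Longrightarrow> u \<in> C_T T (H 2)"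
  using regular by (simp add: regular_solution_def)

lemma density_in_L1: "T > 0 \<Longrightarrow> \<rho> \<in> C_T T L1"
  using sol by (simp add: global_solution_def additional_regularity_def)

lemma velocity_wderivs:
  assumes "t > 0"
  shows "has_wderiv 0 (u t) (u t)" "has_wderiv (Suc 0) (u t) (deriv (u t))"
    "has_wderiv (Suc (Suc 0)) (u t) (deriv (deriv (u t)))"
proof -
  note * = has_wderiv_0[OF continuous_imp_locally_integrable[OF continuous_on_slices(1)[OF _ assms]]]
  show "has_wderiv 0 (u t) (u t)" by (rule *[OF classical_continuity(4)])
  show "has_wderiv (Suc 0) (u t) (deriv (u t))"
    by (rule has_wderiv_Suc[OF classical_derivatives(4)[OF assms] *[OF classical_continuity(6)]])
  show "has_wderiv (Suc (Suc 0)) (u t) (deriv (deriv (u t)))"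
    by (rule has_wderiv_Suc[OF classical_derivatives(4)[OF assms]
          has_wderiv_Suc[OF classical_derivatives(5)[OF assms] *[OF classical_continuity(7)]]])
qed

lemma velocity_bounded:
  assumes "T > 0"
  obtains C where "C > 0" "\<And>t x. t \<in> {0<..T} \<Longrightarrow> \<bar>u t x\<bar> \<le> C"
proof (rule C_T_H_sup_bound[OF velocity_in_H2[OF assms], of 0 u "\<lambda>t. deriv (u t)"])
  fix t assume "t \<in> {0<..T}"
  then have "t > 0" by simp
  then show "has_wderiv 0 (u t) (u t)" "has_wderiv (Suc 0) (u t) (deriv (u t))"
    "\<And>x. (u t has_real_derivative deriv (u t) x) (at x)"
    by (rule velocity_wderivs classical_derivatives)+
qed (use that in auto)

lemma velocity_gradient_bounded:
  assumes "T > 0"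
  obtains C where "C > 0" "\<And>t x. t \<in> {0<..T} \<Longrightarrow> \<bar>deriv (u t) x\<bar> \<le> C"
proof (rule C_T_H_sup_bound[OF velocity_in_H2[OF assms], of "Suc 0" "\<lambda>t. deriv (u t)" "\<lambda>t. deriv (deriv (u t))"])
  fix t assume "t \<in> {0<..T}"
  then have "t > 0" by simp
  then show "has_wderiv (Suc 0) (u t) (deriv (u t))" "has_wderiv (Suc (Suc 0)) (u t) (deriv (deriv (u t)))"
    "\<And>x. (deriv (u t) has_real_derivative deriv (deriv (u t)) x) (at x)"
    by (rule velocity_wderivs classical_derivatives)+
qed (use that in auto)

text \<open>The density itself is controlled only in L^1. The pointwise bound is obtained for the
  power \<gamma> - 1, which lies in H^2, and is carried back by the monotone power 1/(\<gamma> - 1),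
  using \<gamma> > 1.\<close>

lemma density_bounded:
  assumes "T > 0"
  obtains C where "C > 0" "\<And>t x. t \<in> {0<..T} \<Longrightarrow> \<rho> t x \<le> C"
proof -
  let ?w = "\<lambda>t x. \<rho> t x powr (\<gamma> - 1)"
  let ?w' = "\<lambda>t x. (\<gamma> - 1) * \<rho> t x powr (\<gamma> - 1 - 1) * deriv (\<rho> t) x"
  have d: "(?w t has_real_derivative ?w' t x) (at x)" if "t > 0" for t x
    using DERIV_fun_powr[OF classical_derivatives(2)[OF that] density_pos, of "\<gamma> - 1"] that by simp
  have pos: "\<rho> t x \<noteq> 0" if "t > 0" for t x
    using density_pos[of t x] that by simp
  have c: "continuous_on UNIV (?w t)" "continuous_on UNIV (?w' t)" if "t > 0" for t
    using continuous_on_slices(1)[OF classical_continuity(1) that]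
      continuous_on_slices(1)[OF classical_continuity(3) that] pos[OF that]
    by (auto intro!: continuous_intros)
  have w: "?w \<in> C_T T (H 2)"
    using regular[OF assms] by (simp add: regular_solution_def)
  have wd: "has_wderiv 0 (?w t) (?w t)" "has_wderiv (Suc 0) (?w t) (?w' t)" if "t > 0" for t
    using has_wderiv_0[OF continuous_imp_locally_integrable[OF c(1)[OF that]]]
      has_wderiv_Suc[OF d[OF that] has_wderiv_0[OF continuous_imp_locally_integrable[OF c(2)[OF that]]]]
    by blast+
  obtain C where C: "C > 0" "\<And>t x. t \<in> {0<..T} \<Longrightarrow> \<bar>?w t x\<bar> \<le> C"
  proof (rule C_T_H_sup_bound[OF w, of 0 ?w ?w'])
    fix t assume "t \<in> {0<..T}"
    then have "t > 0" by simp
    then show "has_wderiv 0 (?w t) (?w t)" "has_wderiv (Suc 0) (?w t) (?w' t)"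
      "\<And>x. (?w t has_real_derivative ?w' t x) (at x)"
      by (rule wd d)+
  qed (use that in auto)
  show ?thesis
  proof (rule that[of "C powr (1 / (\<gamma> - 1))"])
    fix t x assume t: "t \<in> {0<..T}"
    have "?w t x powr (1 / (\<gamma> - 1)) \<le> C powr (1 / (\<gamma> - 1))"
      using C(2)[OF t, of x] \<gamma> by (intro powr_mono2) auto
    then show "\<rho> t x \<le> C powr (1 / (\<gamma> - 1))"
      using \<gamma> t density_pos[of t x] by (simp add: powr_powr)
  qed (use C in simp)
qed

lemma mass_conserved:
  assumes t: "0 < t1" "t1 \<le> t2"
  shows "(LINT x|lebesgue. \<rho> t1 x) = (LINT x|lebesgue. \<rho> t2 x)"
proof -
  have t2: "t2 > 0" using t by simp
  obtain Cu where Cu: "Cu > 0" "\<And>t x. t \<in> {0<..t2} \<Longrightarrow> \<bar>u t x\<bar> \<le> Cu"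
    using velocity_bounded[OF t2] by blast
  obtain Cr where Cr: "Cr > 0" "\<And>t x. t \<in> {0<..t2} \<Longrightarrow> \<rho> t x \<le> Cr"
    using density_bounded[OF t2] by blast
  show ?thesis
  proof (rule conserved_integral[where G = "\<lambda>t x. \<rho> t x * u t x" and C = "Cr * Cu", OF t(2)])
    fix s assume "s \<in> {t1..t2}"
    then have s: "s > 0" "s \<in> {0<..t2}" "s \<in> {0..t2}" using t by auto
    show "integrable lebesgue (\<rho> s)"
      using density_in_L1[OF t2] s by (simp add: C_T_def L1_def)
    show "((\<lambda>s. \<rho> s x) has_real_derivative deriv (\<lambda>s. \<rho> s x) s) (at s)" for x
      by (rule classical_derivatives(1)[OF s(1)])
    \<comment> \<open>\<open>deriv\<close> is total, so the equation between values of
      \<open>deriv\<close> becomes a statement about derivatives only once the flux is known to be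
      differentiable.\<close>
    have "(\<lambda>y. \<rho> s y * u s y) differentiable (at x)" for x
      using DERIV_mult[OF classical_derivatives(2,4)[OF s(1)]] real_differentiable_def by blast
    moreover have "deriv (\<lambda>y. \<rho> s y * u s y) x = - deriv (\<lambda>s. \<rho> s x) s" for x
      using classical s by (simp add: classical_solution_def eq_neg_iff_add_eq_0 add.commute)
    ultimately show "((\<lambda>y. \<rho> s y * u s y) has_real_derivative - deriv (\<lambda>s. \<rho> s x) s) (at x)" for x
      by (metis DERIV_deriv_iff_real_differentiable)
    show "\<bar>\<rho> s x * u s x\<bar> \<le> Cr * Cu" for x
      using Cr(2)[OF s(2), of x] Cu(2)[OF s(2), of x] density_pos[of s x] s(1)
      by (auto simp: abs_mult intro!: mult_mono)
    show "((\<lambda>x. \<rho> s x * u s x) \<longlongrightarrow> 0) at_infinity"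
      using tendsto_mult[OF far_field[of s]] s(1) by simp
  next
    show "continuous_on ({t1..t2} \<times> UNIV) (\<lambda>(t, x). deriv (\<lambda>s. \<rho> s x) t)"
      by (rule continuous_on_subset[OF classical_continuity(2)]) (use t in auto)
    show "continuous_on {t1..t2} (\<lambda>t. \<rho> t x * u t x)" for x
    proof -
      have sub: "{t1..t2} \<subseteq> {0<..}" using t by auto
      note slice = classical_continuity[THEN continuous_on_slices(2), THEN continuous_on_subset[OF _ sub]]
      show ?thesis by (rule continuous_on_mult[OF slice(1) slice(4)])
    qed
  qed
qed

lemma momentum_conserved:
  assumes t: "0 < t1" "t1 \<le> t2"
  shows "momentum (\<rho> t1) (u t1) = momentum (\<rho> t2) (u t2)"
proof -
  have t2: "t2 > 0" using t by simp
  obtain Cu where Cu: "Cu > 0" "\<And>t x. t \<in> {0<..t2} \<Longrightarrow> \<bar>u t x\<bar> \<le> Cu"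
    using velocity_bounded[OF t2] by blast
  obtain Cx where Cx: "Cx > 0" "\<And>t x. t \<in> {0<..t2} \<Longrightarrow> \<bar>deriv (u t) x\<bar> \<le> Cx"
    using velocity_gradient_bounded[OF t2] by blast
  obtain Cr where Cr: "Cr > 0" "\<And>t x. t \<in> {0<..t2} \<Longrightarrow> \<rho> t x \<le> Cr"
    using density_bounded[OF t2] by blast
  \<comment> \<open>The flux that puts the momentum equation in the form F_t + G_x = 0. The constant
    C used below adds up bounds for its convective, pressure and viscous parts.\<close>
  define G where "G t x = \<rho> t x * (u t x)\<^sup>2 + pressure A \<gamma> (\<rho> t x) - viscosity \<alpha> \<delta> (\<rho> t x) * deriv (u t) x"
    for t x
  define F' where "F' t x = deriv (\<lambda>s. \<rho> s x) t * u t x + deriv (\<lambda>s. u s x) t * \<rho> t x" for t x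
  show ?thesis
    unfolding momentum_def
  proof (rule conserved_integral[OF t(2), where G = G and F' = F'
        and C = "Cr * Cu\<^sup>2 + \<bar>A\<bar> * Cr powr \<gamma> + \<bar>\<alpha>\<bar> * Cr powr \<delta> * Cx"])
    fix s assume "s \<in> {t1..t2}"
    then have s: "s > 0" "s \<in> {0<..t2}" "s \<in> {0..t2}" using t by auto
    have pos: "\<rho> s x > 0" for x using density_pos s by simp
    have "u s \<in> borel_measurable lebesgue"
      by (rule continuous_imp_lebesgue_measurable[OF continuous_on_slices(1)[OF classical_continuity(4) s(1)]])
    then show "integrable lebesgue (\<lambda>x. \<rho> s x * u s x)"
      using density_in_L1[OF t2] s Cu(2)
      by (intro integrable_mult_bounded[where C = Cu]) (auto simp: C_T_def L1_def)
    show dF: "((\<lambda>s. \<rho> s x * u s x) has_real_derivative F' s x) (at s)" for x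
      unfolding F'_def by (rule DERIV_mult[OF classical_derivatives(1,3)[OF s(1)]])
    have "(\<lambda>y. \<rho> s y * (u s y)\<^sup>2) differentiable (at x)" for x
      using classical_derivatives(2,4)[OF s(1)]
      by (intro differentiable_mult differentiable_power) (auto simp: real_differentiable_def)
    moreover have powr: "(\<lambda>y. \<rho> s y powr p) differentiable (at x)" for p x
      using DERIV_fun_powr[OF classical_derivatives(2)[OF s(1)] pos] by (auto simp: real_differentiable_def)
    have "(\<lambda>y. pressure A \<gamma> (\<rho> s y)) differentiable (at x)" for x
      unfolding pressure_def by (intro differentiable_mult powr) simp
    moreover have "(\<lambda>y. viscosity \<alpha> \<delta> (\<rho> s y) * deriv (u s) y) differentiable (at x)" for x
      unfolding viscosity_def using classical_derivatives(5)[OF s(1)]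
      by (intro differentiable_mult powr) (auto simp: real_differentiable_def)
    ultimately have "(G s has_real_derivative deriv (\<lambda>y. \<rho> s y * (u s y)\<^sup>2) x + deriv (\<lambda>y. pressure A \<gamma> (\<rho> s y)) x
        - deriv (\<lambda>y. viscosity \<alpha> \<delta> (\<rho> s y) * deriv (u s) y) x) (at x)" for x
      unfolding G_def by (intro DERIV_diff DERIV_add) (simp_all add: DERIV_deriv_iff_real_differentiable)
    moreover have "deriv (\<lambda>y. \<rho> s y * (u s y)\<^sup>2) x + deriv (\<lambda>y. pressure A \<gamma> (\<rho> s y)) x
        - deriv (\<lambda>y. viscosity \<alpha> \<delta> (\<rho> s y) * deriv (u s) y) x = - F' s x" for x
    proof -
      have "deriv (\<lambda>s. \<rho> s x * u s x) s + deriv (\<lambda>y. \<rho> s y * (u s y)\<^sup>2) x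
        + deriv (\<lambda>y. pressure A \<gamma> (\<rho> s y)) x = deriv (\<lambda>y. viscosity \<alpha> \<delta> (\<rho> s y) * deriv (u s) y) x"
        using classical s(1) unfolding classical_solution_def by blast
      moreover have "b + c - d = - a" if "a + b + c = d" for a b c d :: real
        using that by simp
      ultimately show ?thesis
        unfolding DERIV_imp_deriv[OF dF] by blast
    qed
    ultimately show "(G s has_real_derivative - F' s x) (at x)" for x
      by (rule DERIV_cong)
    show "\<bar>G s x\<bar> \<le> Cr * Cu\<^sup>2 + \<bar>A\<bar> * Cr powr \<gamma> + \<bar>\<alpha>\<bar> * Cr powr \<delta> * Cx" for x
    proof -
      note b = Cr(2)[OF s(2), of x] Cu(2)[OF s(2), of x] Cx(2)[OF s(2), of x] pos[of x]
      have p: "\<rho> s x powr q \<le> Cr powr q" if "q > 0" for q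
        using b that by (intro powr_mono2) auto
      have "\<bar>u s x\<bar>\<^sup>2 \<le> Cu\<^sup>2" by (rule power_mono[OF b(2)]) simp
      then have "\<bar>\<rho> s x * (u s x)\<^sup>2\<bar> \<le> Cr * Cu\<^sup>2"
        using b Cr(1) by (auto simp: abs_mult intro!: mult_mono)
      moreover have "\<bar>pressure A \<gamma> (\<rho> s x)\<bar> \<le> \<bar>A\<bar> * Cr powr \<gamma>"
        using p[of \<gamma>] \<gamma> by (auto simp: pressure_def abs_mult intro!: mult_left_mono)
      moreover have "\<bar>viscosity \<alpha> \<delta> (\<rho> s x) * deriv (u s) x\<bar> \<le> \<bar>\<alpha>\<bar> * Cr powr \<delta> * Cx"
        using p[of \<delta>] \<delta> b(3) by (auto simp: viscosity_def abs_mult intro!: mult_mono)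
      ultimately show ?thesis unfolding G_def by linarith
    qed
    show "(G s \<longlongrightarrow> 0) at_infinity"
    proof -
      have s': "s \<ge> 0" using s by simp
      have p: "((\<lambda>x. \<rho> s x powr q) \<longlongrightarrow> 0) at_infinity" if "q > 0" for q
        using tendsto_powr'[OF far_field(1)[OF s'] tendsto_const[of q]] that pos
        by (simp add: less_imp_le)
      \<comment> \<open>Boundedness of the velocity gradient is enough here, since the other factor
        decays thanks to \<delta> > 0.\<close>
      have visc: "((\<lambda>x. \<rho> s x powr \<delta> * deriv (u s) x) \<longlongrightarrow> 0) at_infinity"
      proof (rule Lim_null_comparison)
        show "\<forall>\<^sub>F x in at_infinity. norm (\<rho> s x powr \<delta> * deriv (u s) x) \<le> \<rho> s x powr \<delta> * Cx"
          using Cx(2)[OF s(2)] by (auto simp: abs_mult intro!: always_eventually mult_left_mono)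
        show "((\<lambda>x. \<rho> s x powr \<delta> * Cx) \<longlongrightarrow> 0) at_infinity"
          using tendsto_mult_right[OF p[OF \<delta>], of Cx] by simp
      qed
      have "((\<lambda>x. viscosity \<alpha> \<delta> (\<rho> s x) * deriv (u s) x) \<longlongrightarrow> 0) at_infinity"
        using tendsto_mult_left[OF visc, of \<alpha>] by (simp add: viscosity_def mult.assoc)
      moreover have "((\<lambda>x. pressure A \<gamma> (\<rho> s x)) \<longlongrightarrow> 0) at_infinity"
        using tendsto_mult_left[OF p[of \<gamma>], of A] \<gamma> by (simp add: pressure_def)
      moreover have "((\<lambda>x. \<rho> s x * (u s x)\<^sup>2) \<longlongrightarrow> 0) at_infinity"
        using tendsto_mult[OF far_field(1)[OF s'] tendsto_power[OF far_field(2)[OF s'], of 2]] by simp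
      ultimately have "((\<lambda>x. G s x) \<longlongrightarrow> 0 + 0 - 0) at_infinity"
        unfolding G_def by (intro tendsto_diff[OF tendsto_add])
      then show ?thesis by simp
    qed
  next
    have sub: "{t1..t2} \<times> UNIV \<subseteq> {0<..} \<times> (UNIV :: real set)" and sub': "{t1..t2} \<subseteq> {0<..}"
      using t by auto
    note cont = classical_continuity[THEN continuous_on_subset[OF _ sub]]
    show "continuous_on ({t1..t2} \<times> UNIV) (\<lambda>(t, x). F' t x)"
      using cont(1,2,4,5) unfolding F'_def by (auto simp: case_prod_unfold intro!: continuous_intros)
    note slice = classical_continuity[THEN continuous_on_slices(2), THEN continuous_on_subset[OF _ sub']]
    have "\<rho> t x \<noteq> 0" if "t \<in> {t1..t2}" for t x
      using density_pos[of t x] that t by simp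
    then show "continuous_on {t1..t2} (\<lambda>t. G t x)" for x
      unfolding G_def pressure_def viscosity_def using slice(1,4,6)
      by (intro continuous_intros) auto
  qed
qed

text \<open>Conservation at positive times makes the sequence from
  \<open>momentum_initial_limit\<close> constant, so one sequence of times tending to 0 determines
  the value.\<close>

lemma momentum_eq_initial:
  assumes t: "t > 0"
  shows "momentum (\<rho> t) (u t) = momentum (\<rho> 0) (u 0)"
proof -
  obtain C where "\<And>s x. s \<in> {0<..t} \<Longrightarrow> \<bar>u s x\<bar> \<le> C"
    using velocity_bounded[OF t] by blast
  then obtain s where s: "\<And>n. s n \<in> {0<..t}"
    "(\<lambda>n. momentum (\<rho> (s n)) (u (s n))) \<longlonglongrightarrow> momentum (\<rho> 0) (u 0)"
    using momentum_initial_limit[OF t density_in_L1[OF t] velocity_in_H2[OF t]] by blast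
  then have "momentum (\<rho> (s n)) (u (s n)) = momentum (\<rho> t) (u t)" for n
    using momentum_conserved[of "s n" t] by simp
  then show ?thesis
    using s(2) LIMSEQ_unique[OF tendsto_const] by simp
qed

lemma momentum_le:
  assumes t: "t > 0" and \<epsilon>: "Linf_norm (u t) \<le> ereal \<epsilon>"
  shows "\<bar>momentum (\<rho> t) (u t)\<bar> \<le> (LINT x|lebesgue. \<rho> t x) * \<epsilon>"
proof -
  have ae: "AE x in lebesgue. \<bar>u t x\<bar> \<le> \<epsilon>"
    using esssup_AE[of "\<lambda>x. ereal \<bar>u t x\<bar>" lebesgue]
  proof eventually_elim
    case (elim x)
    then show ?case using \<epsilon> unfolding Linf_norm_def by (meson ereal_less_eq(3) order_trans)
  qed
  have int: "integrable lebesgue (\<rho> t)"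
    using density_in_L1[OF t] t by (simp add: C_T_def L1_def)
  have meas: "u t \<in> borel_measurable lebesgue"
    by (rule continuous_imp_lebesgue_measurable[OF continuous_on_slices(1)[OF classical_continuity(4) t]])
  have "\<bar>momentum (\<rho> t) (u t)\<bar> \<le> (LINT x|lebesgue. \<bar>\<rho> t x * u t x\<bar>)"
    unfolding momentum_def by (rule integral_abs_bound)
  also have "\<dots> \<le> (LINT x|lebesgue. \<rho> t x * \<epsilon>)"
  proof (rule integral_mono_AE)
    show "AE x in lebesgue. \<bar>\<rho> t x * u t x\<bar> \<le> \<rho> t x * \<epsilon>"
      using ae
    proof eventually_elim
      case (elim x)
      then show ?case using density_pos[of t x] t by (simp add: abs_mult)
    qed
  qed (use integrable_mult_bounded[OF int meas ae] int in auto)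
  finally show ?thesis by simp
qed

end

section \<open>Contradiction between conserved momentum and decaying velocity\<close>

theorem corollary1p1:
  fixes A \<alpha> \<gamma> \<delta> :: real
    and \<rho>0 u0 :: "real \<Rightarrow> real"
    and \<rho> u :: "real \<Rightarrow> real \<Rightarrow> real"
  assumes "A > 0" and "\<alpha> > 0"
    and "assumptions_i \<alpha> \<gamma> \<delta> \<rho>0 u0 \<or> assumptions_ii \<gamma> \<delta> \<rho>0 u0"
    and "global_solution A \<alpha> \<gamma> \<delta> \<rho>0 u0 \<rho> u"
    and "\<bar>momentum \<rho>0 u0\<bar> > 0"
  shows "\<not> Limsup at_top (\<lambda>t. Linf_norm (u t)) = 0"
proof
  assume lim: "Limsup at_top (\<lambda>t. Linf_norm (u t)) = 0"
  note sol = assms(4)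
  have \<gamma>: "\<gamma> > 1" and \<delta>: "\<delta> > 0"
    and \<rho>0: "\<rho>0 \<in> elems L1" and u0: "u0 \<in> elems (H 2)"
    using assms(3) by (auto simp: assumptions_i_def assumptions_ii_def)
  note ctx = sol \<gamma> \<delta>
  \<comment> \<open>The initial data are attained only almost everywhere, so the two momenta are
    compared as integrals.\<close>
  have init: "momentum (\<rho> 0) (u 0) = momentum \<rho>0 u0"
    unfolding momentum_def
  proof (rule integral_cong_AE)
    have "\<rho> 0 \<in> elems L1" and "u 0 \<in> elems (H 2)"
      using density_in_L1[OF ctx, of 1] velocity_in_H2[OF ctx, of 1] by (auto simp: C_T_def)
    note this(1) \<rho>0 and this(2)[THEN H_locally_integrable, THEN locally_integrable_measurable]
      and u0[THEN H_locally_integrable, THEN locally_integrable_measurable]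
    then show "(\<lambda>x. \<rho> 0 x * u 0 x) \<in> borel_measurable lebesgue" "(\<lambda>x. \<rho>0 x * u0 x) \<in> borel_measurable lebesgue"
      by (auto simp: L1_def intro!: borel_measurable_times)
    have "AE x in lebesgue. \<rho> 0 x = \<rho>0 x \<and> u 0 x = u0 x"
      using regular[OF ctx, of 1] by (simp add: regular_solution_def distributional_solution_def)
    then show "AE x in lebesgue. \<rho> 0 x * u 0 x = \<rho>0 x * u0 x"
      by eventually_elim simp
  qed
  \<comment> \<open>The mass is taken at time 1 because \<open>mass_conserved\<close> is confined to
    positive times; this is also why t is later chosen to be at least 1.\<close>
  define M where "M = (LINT x|lebesgue. \<rho> 1 x)"
  have "M \<ge> 0"
    unfolding M_def using density_pos[OF ctx, of 1] by (intro Bochner_Integration.integral_nonneg) (simp add: less_imp_le)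
  \<comment> \<open>Chosen so that M \<epsilon> falls strictly below the initial momentum. Dividing
    by M + 1 keeps the quotient meaningful with nothing more than M \<ge> 0.\<close>
  define \<epsilon> where "\<epsilon> = \<bar>momentum \<rho>0 u0\<bar> / (M + 1)"
  have "\<epsilon> > 0" using assms(5) \<open>M \<ge> 0\<close> by (simp add: \<epsilon>_def)
  then have "\<forall>\<^sub>F t in at_top. Linf_norm (u t) < ereal \<epsilon>"
    by (intro Limsup_lessD) (simp add: lim)
  then have "\<forall>\<^sub>F t in at_top. Linf_norm (u t) < ereal \<epsilon> \<and> t \<ge> 1"
    using eventually_ge_at_top[of "1::real"] by eventually_elim simp
  then obtain t where t: "Linf_norm (u t) < ereal \<epsilon>" "t \<ge> 1"
    using eventually_happens by fastforce
  have "\<bar>momentum \<rho>0 u0\<bar> \<le> M * \<epsilon>"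
    using momentum_le[OF ctx, of t \<epsilon>] momentum_eq_initial[OF ctx, of t] mass_conserved[OF ctx, of 1 t] t init
    by (simp add: M_def less_imp_le)
  also have "\<dots> < (M + 1) * \<epsilon>" using \<open>\<epsilon> > 0\<close> by simp
  also have "\<dots> = \<bar>momentum \<rho>0 u0\<bar>" using \<open>M \<ge> 0\<close> by (simp add: \<epsilon>_def)
  finally show False by simp
qed

end
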